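(* Let $V$ be the Volterra operator on $L^2[0,1]$ and let $S$ be the Donoghue operator on $l^2$ with a positive weight sequence. Then $V$ is in the radical of the Banach algebra generated by $\langle V]\cup[V\rangle$, and $S$ is in the radical of the Banach algebra generated by $\langle S]\cup[S\rangle$.
   Context: The Volterra operator on $L^2[0,1]$ is $(Vf)(x)=\int_0^x f(t)\,dt$. Let $\{e_n\}_{n\ge 0}$ be the standard orthonormal basis of $l^2$, and let $\{w_n\}_{n\ge 1}$ be a monotone decreasing sequence of positive numbers with $\{w_n\}\in l^2$. The (positive) Donoghue operator $S$ with weight sequence $\{w_n\}$ is the bounded operator on $l^2$ determined by $Se_0=0$ and $Se_n=w_ne_{n-1}$ for $n\ge 1$. $L^2[0,1]$ carries the usual almost-everywhere order and $l^2$ the componentwise order; both are Banach lattices. An operator on a Banach lattice $E$ is positive if it maps $E^+$ into itself; $P\ge Q$ means $P-Q$ is positive; $\mathcal L_+(E)$ is the set of positive operators on $E$. For a positive operator $A$ on $E$, the super right-commutant and super left-commutant are $$[A\rangle=\{B\in\mathcal L_+(E): BA\ge AB\},\qquad \langle A]=\{B\in\mathcal L_+(E): AB\ge BA\}.$$ The Banach algebra generated by a set of operators is the norm closure of the algebra generated by that set. The radical of a Banach algebra $\mathcal A$ is the intersection of all maximal modular left ideals of $\mathcal A$ (equivalently, of all maximal modular right ideals); if $\mathcal A$ is unital it equals $\{a\in\mathcal A: r(ba)=0 \text{ for all } b\in\mathcal A\}=\{a\in\mathcal A: r(ab)=0 \text{ for all } b\in\mathcal A\}$, where $r$ is the spectral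 radius. For a non-unital algebra, spectra are computed in the standard unitization. *)

theory Defs
  imports "HOL-Analysis.Analysis" "HOL-Library.Nonpos_Ints"
begin

text \<open>
  Scalars.  Everything is done over a scalar field \<open>'k\<close> of sort
  \<open>{real_normed_field, euclidean_space}\<close>: a finite-dimensional real field with a
  multiplicative norm, i.e. \<open>\<real>\<close> or \<open>\<complex>\<close>; both \<^typ>\<open>real\<close> and \<^typ>\<open>complex\<close> are
  instances.  The real and the complex spaces \<open>L\<^sup>2[0,1]\<close>, \<open>l\<^sup>2\<close> are thus treated at once.
  The set \<open>\<real>\<^sub>\<ge>\<^sub>0\<close> of nonnegative real scalars in \<open>'k\<close> is the library's \<^const>\<open>nonneg_Reals\<close>;
  it determines the orders on function spaces (in the complex case \<open>f \<le> g\<close> means that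
  \<open>g - f\<close> is real and nonnegative, so that the positive cone is that of the real space).
\<close>

section \<open>Square integrable functions\<close>

definition square_integrable :: "'a measure \<Rightarrow> ('a \<Rightarrow> 'k::{real_normed_field, euclidean_space}) set"
  where "square_integrable M =
    {f \<in> borel_measurable M. integrable M (\<lambda>x. (norm (f x))\<^sup>2)}"

definition norm2 :: "'a measure \<Rightarrow> ('a \<Rightarrow> 'k::{real_normed_field, euclidean_space}) \<Rightarrow> real"
  where "norm2 M f = sqrt (\<integral>x. (norm (f x))\<^sup>2 \<partial>M)"

lemma square_integrable_measurable [measurable_dest]:
  "f \<in> square_integrable M \<Longrightarrow> f \<in> borel_measurable M"
  by (simp add: square_integrable_def)

lemma square_integrable_integrable:
  "f \<in> square_integrable M \<Longrightarrow> integrable M (\<lambda>x. (norm (f x))\<^sup>2)"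
  by (simp add: square_integrable_def)

lemma norm2_nonneg [simp]: "0 \<le> norm2 M f"
  by (simp add: norm2_def)

lemma norm2_square: "(norm2 M f)\<^sup>2 = (\<integral>x. (norm (f x))\<^sup>2 \<partial>M)"
  by (simp add: norm2_def)

lemma norm2_cong_AE:
  assumes "f \<in> borel_measurable M" "g \<in> borel_measurable M" "AE x in M. f x = g x"
  shows "norm2 M f = norm2 M g"
  unfolding norm2_def using assms
  by (intro arg_cong[where f = sqrt] integral_cong_AE) auto

lemma norm2_eq_0_iff:
  assumes "f \<in> square_integrable M"
  shows "norm2 M f = 0 \<longleftrightarrow> (AE x in M. f x = 0)"
  unfolding norm2_def
  using integral_nonneg_eq_0_iff_AE[OF square_integrable_integrable[OF assms]] by simp

lemma square_integrable_mult_integrable: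
  assumes f: "f \<in> square_integrable M" and g: "g \<in> square_integrable M"
  shows "integrable M (\<lambda>x. norm (f x) * norm (g x))"
proof (rule Bochner_Integration.integrable_bound)
  show "integrable M (\<lambda>x. (norm (f x))\<^sup>2 + (norm (g x))\<^sup>2)"
    using f g by (intro Bochner_Integration.integrable_add square_integrable_integrable)
  show "(\<lambda>x. norm (f x) * norm (g x)) \<in> borel_measurable M"
    using f g by measurable
  have "a * b \<le> a\<^sup>2 + b\<^sup>2" if "a \<ge> 0" "b \<ge> 0" for a b :: real
    using sum_squares_bound[of a b] mult_nonneg_nonneg[OF that] by linarith
  then show "AE x in M. norm (norm (f x) * norm (g x)) \<le> norm ((norm (f x))\<^sup>2 + (norm (g x))\<^sup>2)"
    by auto
qed

lemma square_integrable_Cauchy_Schwarz: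
  assumes f: "f \<in> square_integrable M" and g: "g \<in> square_integrable M"
  shows "(\<integral>x. norm (f x) * norm (g x) \<partial>M) \<le> norm2 M f * norm2 M g"
proof (cases "norm2 M f = 0 \<or> norm2 M g = 0")
  case True
  then have "AE x in M. norm (f x) * norm (g x) = 0"
    using norm2_eq_0_iff[OF f] norm2_eq_0_iff[OF g] by (auto elim: eventually_mono)
  then have "(\<integral>x. norm (f x) * norm (g x) \<partial>M) = 0"
    by (rule integral_eq_zero_AE)
  with True show ?thesis by auto
next
  case False
  define A B where "A = norm2 M f" and "B = norm2 M g"
  have AB: "A > 0" "B > 0"
    using False norm2_nonneg[of M f] norm2_nonneg[of M g] by (auto simp: A_def B_def less_le)
  have "(\<integral>x. norm (f x) * norm (g x) \<partial>M)
      \<le> (\<integral>x. (B / A * (norm (f x))\<^sup>2 + A / B * (norm (g x))\<^sup>2) / 2 \<partial>M)"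
  proof (rule integral_mono)
    show "integrable M (\<lambda>x. (B / A * (norm (f x))\<^sup>2 + A / B * (norm (g x))\<^sup>2) / 2)"
      using square_integrable_integrable[OF f] square_integrable_integrable[OF g]
      by (intro integrable_divide_zero Bochner_Integration.integrable_add integrable_mult_right)
    fix x
    have "0 \<le> (B * norm (f x) - A * norm (g x))\<^sup>2 / (A * B)" using AB by simp
    also have "\<dots> = B / A * (norm (f x))\<^sup>2 + A / B * (norm (g x))\<^sup>2 - 2 * (norm (f x) * norm (g x))"
      using AB by (simp add: field_simps power2_eq_square)
    finally show "norm (f x) * norm (g x) \<le> (B / A * (norm (f x))\<^sup>2 + A / B * (norm (g x))\<^sup>2) / 2"
      by simp
  qed (rule square_integrable_mult_integrable[OF f g])
  also have "\<dots> = (B / A * A\<^sup>2 + A / B * B\<^sup>2) / 2"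
    using f g unfolding A_def B_def norm2_square
    by (simp add: square_integrable_integrable)
  also have "\<dots> = A * B" using AB by (simp add: power2_eq_square)
  finally show ?thesis by (simp add: A_def B_def)
qed

lemma square_integrable_add:
  assumes f: "f \<in> square_integrable M" and g: "g \<in> square_integrable M"
  shows "(\<lambda>x. f x + g x) \<in> square_integrable M"
proof -
  have "integrable M (\<lambda>x. (norm (f x + g x))\<^sup>2)"
  proof (rule Bochner_Integration.integrable_bound)
    show "integrable M (\<lambda>x. (norm (f x))\<^sup>2 + 2 * (norm (f x) * norm (g x)) + (norm (g x))\<^sup>2)"
      using f g
      by (intro Bochner_Integration.integrable_add square_integrable_integrable
            integrable_mult_right square_integrable_mult_integrable)
    show "(\<lambda>x. (norm (f x + g x))\<^sup>2) \<in> borel_measurable M" using f g by measurable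
    have "(norm (f x + g x))\<^sup>2 \<le> (norm (f x) + norm (g x))\<^sup>2" for x
      by (intro power_mono norm_triangle_ineq) auto
    then show "AE x in M. norm ((norm (f x + g x))\<^sup>2)
        \<le> norm ((norm (f x))\<^sup>2 + 2 * (norm (f x) * norm (g x)) + (norm (g x))\<^sup>2)"
      by (intro AE_I2) (simp add: power2_sum algebra_simps)
  qed
  with f g show ?thesis by (auto simp: square_integrable_def)
qed

lemma norm2_triangle:
  assumes f: "f \<in> square_integrable M" and g: "g \<in> square_integrable M"
  shows "norm2 M (\<lambda>x. f x + g x) \<le> norm2 M f + norm2 M g"
proof (rule power2_le_imp_le)
  have "(norm2 M (\<lambda>x. f x + g x))\<^sup>2
      \<le> (\<integral>x. (norm (f x))\<^sup>2 + 2 * (norm (f x) * norm (g x)) + (norm (g x))\<^sup>2 \<partial>M)"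
    unfolding norm2_square
  proof (rule integral_mono)
    show "integrable M (\<lambda>x. (norm (f x))\<^sup>2 + 2 * (norm (f x) * norm (g x)) + (norm (g x))\<^sup>2)"
      using f g
      by (intro Bochner_Integration.integrable_add square_integrable_integrable
            integrable_mult_right square_integrable_mult_integrable)
    fix x
    have "(norm (f x + g x))\<^sup>2 \<le> (norm (f x) + norm (g x))\<^sup>2"
      by (intro power_mono norm_triangle_ineq) auto
    then show "(norm (f x + g x))\<^sup>2
        \<le> (norm (f x))\<^sup>2 + 2 * (norm (f x) * norm (g x)) + (norm (g x))\<^sup>2"
      by (simp add: power2_sum algebra_simps)
  qed (rule square_integrable_integrable[OF square_integrable_add[OF f g]])
  also have "\<dots> = (norm2 M f)\<^sup>2 + 2 * (\<integral>x. norm (f x) * norm (g x) \<partial>M) + (norm2 M g)\<^sup>2"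
    using f g unfolding norm2_square
    by (simp add: square_integrable_integrable square_integrable_mult_integrable)
  also have "\<dots> \<le> (norm2 M f + norm2 M g)\<^sup>2"
    using square_integrable_Cauchy_Schwarz[OF f g] by (simp add: power2_sum)
  finally show "(norm2 M (\<lambda>x. f x + g x))\<^sup>2 \<le> (norm2 M f + norm2 M g)\<^sup>2" .
qed simp

lemma square_integrable_zero: "(\<lambda>x. 0) \<in> square_integrable M"
  by (simp add: square_integrable_def)

lemma square_integrable_scale:
  assumes "f \<in> square_integrable M"
  shows "(\<lambda>x. c * f x) \<in> square_integrable M"
  using assms by (auto simp: square_integrable_def norm_mult power_mult_distrib)

lemma square_integrable_scaleR:
  assumes "f \<in> square_integrable M"
  shows "(\<lambda>x. r *\<^sub>R f x) \<in> square_integrable M"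
  using assms by (auto simp: square_integrable_def power_mult_distrib)

lemma square_integrable_uminus:
  assumes "f \<in> square_integrable M"
  shows "(\<lambda>x. - f x) \<in> square_integrable M"
  using assms by (auto simp: square_integrable_def)

lemma square_integrable_diff:
  assumes "f \<in> square_integrable M" "g \<in> square_integrable M"
  shows "(\<lambda>x. f x - g x) \<in> square_integrable M"
  using square_integrable_add[OF assms(1) square_integrable_uminus[OF assms(2)]] by simp

lemma norm2_scale: "norm2 M (\<lambda>x. c * f x) = norm c * norm2 M f"
  by (simp add: norm2_def norm_mult power_mult_distrib real_sqrt_mult)

lemma norm2_scaleR: "norm2 M (\<lambda>x. r *\<^sub>R f x) = \<bar>r\<bar> * norm2 M f"
  by (simp add: norm2_def power_mult_distrib real_sqrt_mult)

lemma nonneg_Reals_antisym: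
  fixes x :: "'k::{real_normed_field, euclidean_space}"
  assumes "x \<in> \<real>\<^sub>\<ge>\<^sub>0" "- x \<in> \<real>\<^sub>\<ge>\<^sub>0" shows "x = 0"
proof -
  obtain r s where rs: "x = of_real r" "r \<ge> 0" "- x = of_real s" "s \<ge> 0"
    using assms by (auto simp: nonneg_Reals_def)
  then have "of_real (r + s) = (0 :: 'k)" by (metis add.right_inverse of_real_add)
  then have "r + s = 0" by (simp only: of_real_eq_0_iff)
  with rs show ?thesis by simp
qed

lemma nonneg_Reals_scaleR:
  fixes x :: "'k::{real_normed_field, euclidean_space}"
  assumes "x \<in> \<real>\<^sub>\<ge>\<^sub>0" "r \<ge> 0" shows "r *\<^sub>R x \<in> \<real>\<^sub>\<ge>\<^sub>0"
  using nonneg_Reals_mult_I[of "of_real r" x] assms by (simp add: scaleR_conv_of_real)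


section \<open>The space \<open>L\<^sup>2[0,1]\<close>\<close>

abbreviation unit_measure :: "real measure"
  where "unit_measure \<equiv> lebesgue_on {0..1}"

definition L2_rel ::
    "(real \<Rightarrow> 'k::{real_normed_field, euclidean_space}) \<Rightarrow> (real \<Rightarrow> 'k) \<Rightarrow> bool"
  where "L2_rel f g \<longleftrightarrow> f \<in> square_integrable unit_measure \<and> g \<in> square_integrable unit_measure
    \<and> (AE x in unit_measure. f x = g x)"

quotient_type (overloaded) 'k L2 =
  "real \<Rightarrow> 'k::{real_normed_field, euclidean_space}" / partial: L2_rel
proof (rule part_equivpI)
  show "\<exists>f. L2_rel f (f :: real \<Rightarrow> 'k)"
    by (rule exI[of _ "\<lambda>_. 0"]) (simp add: L2_rel_def square_integrable_zero)
  show "symp (L2_rel :: _ \<Rightarrow> (real \<Rightarrow> 'k) \<Rightarrow> bool)"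
    by (rule sympI) (auto simp: L2_rel_def elim: eventually_mono)
  show "transp (L2_rel :: _ \<Rightarrow> (real \<Rightarrow> 'k) \<Rightarrow> bool)"
    by (rule transpI) (auto simp: L2_rel_def elim: eventually_elim2)
qed

instantiation L2 :: ("{real_normed_field, euclidean_space}") real_vector
begin

lift_definition zero_L2 :: "'a L2" is "\<lambda>x. 0"
  by (simp add: L2_rel_def square_integrable_zero)

lift_definition plus_L2 :: "'a L2 \<Rightarrow> 'a L2 \<Rightarrow> 'a L2" is "\<lambda>f g x. f x + g x"
  by (auto simp: L2_rel_def square_integrable_add elim: eventually_elim2)

lift_definition minus_L2 :: "'a L2 \<Rightarrow> 'a L2 \<Rightarrow> 'a L2" is "\<lambda>f g x. f x - g x"
  by (auto simp: L2_rel_def square_integrable_diff elim: eventually_elim2)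

lift_definition uminus_L2 :: "'a L2 \<Rightarrow> 'a L2" is "\<lambda>f x. - f x"
  by (auto simp: L2_rel_def square_integrable_uminus elim: eventually_mono)

lift_definition scaleR_L2 :: "real \<Rightarrow> 'a L2 \<Rightarrow> 'a L2" is "\<lambda>r f x. r *\<^sub>R f x"
  by (auto simp: L2_rel_def square_integrable_scaleR elim: eventually_mono)

instance
proof
  fix f g h :: "'a L2" and r s :: real
  show "f + g + h = f + (g + h)"
    by transfer (auto simp: L2_rel_def add.assoc intro!: square_integrable_add)
  show "f + g = g + f"
    by transfer (auto simp: L2_rel_def add.commute intro!: square_integrable_add)
  show "0 + f = f" by transfer (auto simp: L2_rel_def)
  show "- f + f = 0" by transfer (auto simp: L2_rel_def square_integrable_zero)
  show "f - g = f + - g"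
    by transfer (auto simp: L2_rel_def intro!: square_integrable_diff)
  show "r *\<^sub>R (f + g) = r *\<^sub>R f + r *\<^sub>R g"
    by transfer (auto simp: L2_rel_def scaleR_add_right
        intro!: square_integrable_add square_integrable_scaleR)
  show "(r + s) *\<^sub>R f = r *\<^sub>R f + s *\<^sub>R f"
    by transfer (auto simp: L2_rel_def scaleR_add_left
        intro!: square_integrable_add square_integrable_scaleR)
  show "r *\<^sub>R s *\<^sub>R f = (r * s) *\<^sub>R f"
    by transfer (auto simp: L2_rel_def intro!: square_integrable_scaleR)
  show "1 *\<^sub>R f = f" by transfer (auto simp: L2_rel_def)
qed

end

instantiation L2 :: ("{real_normed_field, euclidean_space}") real_normed_vector
begin

lift_definition norm_L2 :: "'a L2 \<Rightarrow> real" is "norm2 unit_measure"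
  by (auto simp: L2_rel_def intro!: norm2_cong_AE square_integrable_measurable)

definition sgn_L2 :: "'a L2 \<Rightarrow> 'a L2" where "sgn_L2 f = f /\<^sub>R norm f"

definition dist_L2 :: "'a L2 \<Rightarrow> 'a L2 \<Rightarrow> real" where "dist_L2 f g = norm (f - g)"

definition uniformity_L2 :: "('a L2 \<times> 'a L2) filter"
  where "uniformity_L2 = (INF e\<in>{0<..}. principal {(x, y). dist x y < e})"

definition open_L2 :: "'a L2 set \<Rightarrow> bool"
  where "open_L2 U \<longleftrightarrow> (\<forall>x\<in>U. eventually (\<lambda>(x', y). x' = x \<longrightarrow> y \<in> U) uniformity)"

instance
proof
  fix f g h :: "'a L2" and r s :: real
  show "sgn f = f /\<^sub>R norm f" by (rule sgn_L2_def)
  show "dist f g = norm (f - g)" by (rule dist_L2_def)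
  show "uniformity = (INF e\<in>{0<..}. principal {(x, y::'a L2). dist x y < e})"
    by (rule uniformity_L2_def)
  show "open U \<longleftrightarrow> (\<forall>x\<in>U. eventually (\<lambda>(x', y). x' = x \<longrightarrow> y \<in> U) uniformity)"
    for U :: "'a L2 set"
    by (rule open_L2_def)
  show "norm f = 0 \<longleftrightarrow> f = 0"
    by transfer (auto simp: L2_rel_def norm2_eq_0_iff square_integrable_zero)
  show "norm (f + g) \<le> norm f + norm g"
    by transfer (auto simp: L2_rel_def intro!: norm2_triangle)
  show "norm (r *\<^sub>R f) = \<bar>r\<bar> * norm f"
    by transfer (simp add: norm2_scaleR)
qed

end

instantiation L2 :: ("{real_normed_field, euclidean_space}") ordered_real_vector
begin

lift_definition less_eq_L2 :: "'a L2 \<Rightarrow> 'a L2 \<Rightarrow> bool"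
  is "\<lambda>f g. AE x in unit_measure. g x - f x \<in> \<real>\<^sub>\<ge>\<^sub>0"
proof -
  fix f f' g g' :: "real \<Rightarrow> 'a"
  assume "L2_rel f f'" "L2_rel g g'"
  then have "AE x in unit_measure. f x = f' x \<and> g x = g' x" by (auto simp: L2_rel_def)
  then have "AE x in unit_measure. (g x - f x \<in> \<real>\<^sub>\<ge>\<^sub>0) = (g' x - f' x \<in> \<real>\<^sub>\<ge>\<^sub>0)"
    by (rule eventually_mono) auto
  then show "(AE x in unit_measure. g x - f x \<in> \<real>\<^sub>\<ge>\<^sub>0) = (AE x in unit_measure. g' x - f' x \<in> \<real>\<^sub>\<ge>\<^sub>0)"
    by (rule eventually_subst)
qed

definition less_L2 :: "'a L2 \<Rightarrow> 'a L2 \<Rightarrow> bool" where "less_L2 f g \<longleftrightarrow> f \<le> g \<and> \<not> g \<le> f"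

instance
proof
  fix f g h :: "'a L2" and r s :: real
  show "(f < g) = (f \<le> g \<and> \<not> g \<le> f)" by (rule less_L2_def)
  show "f \<le> f" by transfer auto
  show trans: "f \<le> h" if "f \<le> g" "g \<le> h"
    using that
  proof (transfer)
    fix f g h :: "real \<Rightarrow> 'a"
    assume "AE x in unit_measure. g x - f x \<in> \<real>\<^sub>\<ge>\<^sub>0" "AE x in unit_measure. h x - g x \<in> \<real>\<^sub>\<ge>\<^sub>0"
    then show "AE x in unit_measure. h x - f x \<in> \<real>\<^sub>\<ge>\<^sub>0"
    proof eventually_elim
      case (elim x)
      from nonneg_Reals_add_I[OF elim] show ?case by simp
    qed
  qed
  show "f = g" if "f \<le> g" "g \<le> f"
    using that
  proof (transfer)
    fix f g :: "real \<Rightarrow> 'a"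
    assume fg: "L2_rel f f" "L2_rel g g" 
      and "AE x in unit_measure. g x - f x \<in> \<real>\<^sub>\<ge>\<^sub>0" "AE x in unit_measure. f x - g x \<in> \<real>\<^sub>\<ge>\<^sub>0"
    from this(3,4) have "AE x in unit_measure. f x = g x"
    proof eventually_elim
      case (elim x)
      with nonneg_Reals_antisym[of "f x - g x"] show ?case by simp
    qed
    with fg show "L2_rel f g" by (simp add: L2_rel_def)
  qed
  show "h + f \<le> h + g" if "f \<le> g" using that by transfer simp
  show "r *\<^sub>R f \<le> r *\<^sub>R g" if "f \<le> g" "0 \<le> r"
    using that by transfer
      (auto simp: scaleR_diff_right[symmetric] intro: nonneg_Reals_scaleR elim!: eventually_mono)
  show "r *\<^sub>R f \<le> s *\<^sub>R f" if "r \<le> s" "0 \<le> f"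
    using that by transfer
      (auto simp: scaleR_diff_left[symmetric] intro: nonneg_Reals_scaleR elim!: eventually_mono)
qed

end

lift_definition scale_L2 :: "'k \<Rightarrow> 'k L2 \<Rightarrow> 'k::{real_normed_field, euclidean_space} L2"
  is "\<lambda>c f x. c * f x"
  by (auto simp: L2_rel_def square_integrable_scale elim: eventually_mono)

lemma norm_scale_L2: "norm (scale_L2 c f) = norm c * norm f"
  by transfer (rule norm2_scale)

lemma scale_L2_of_real: "scale_L2 (of_real r) f = r *\<^sub>R f"
  by transfer (simp add: L2_rel_def scaleR_conv_of_real square_integrable_scale)

lemma vector_space_L2:
  "vector_space (scale_L2 :: 'k \<Rightarrow> _ \<Rightarrow> 'k::{real_normed_field, euclidean_space} L2)"
proof
  fix a b :: 'k and f g :: "'k L2"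
  show "scale_L2 a (f + g) = scale_L2 a f + scale_L2 a g"
    by transfer (auto simp: L2_rel_def algebra_simps
        intro!: square_integrable_add square_integrable_scale)
  show "scale_L2 (a + b) f = scale_L2 a f + scale_L2 b f"
    by transfer (auto simp: L2_rel_def algebra_simps
        intro!: square_integrable_add square_integrable_scale)
  show "scale_L2 a (scale_L2 b f) = scale_L2 (a * b) f"
    by transfer (auto simp: L2_rel_def algebra_simps intro!: square_integrable_scale)
  show "scale_L2 1 f = f" by transfer (simp add: L2_rel_def)
qed


section \<open>The space \<open>l\<^sup>2\<close>\<close>

typedef (overloaded) 'k l2 =
  "{x :: nat \<Rightarrow> 'k::{real_normed_field, euclidean_space}. summable (\<lambda>n. (norm (x n))\<^sup>2)}"
  by (rule exI[of _ "\<lambda>_. 0"]) simp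

setup_lifting type_definition_l2

lemma square_integrable_count_space:
  "square_integrable (count_space UNIV) =
    {x :: nat \<Rightarrow> 'k::{real_normed_field, euclidean_space}. summable (\<lambda>n. (norm (x n))\<^sup>2)}"
  by (auto simp: square_integrable_def integrable_count_space_nat_iff)

lemma norm2_count_space:
  fixes x :: "nat \<Rightarrow> 'k::{real_normed_field, euclidean_space}"
  assumes "summable (\<lambda>n. (norm (x n))\<^sup>2)"
  shows "norm2 (count_space UNIV) x = sqrt (\<Sum>n. (norm (x n))\<^sup>2)"
  unfolding norm2_def using assms
  by (subst integral_count_space_nat) (auto simp: integrable_count_space_nat_iff)

instantiation l2 :: ("{real_normed_field, euclidean_space}") real_vector
begin

lift_definition zero_l2 :: "'a l2" is "\<lambda>n. 0" by simp

lift_definition plus_l2 :: "'a l2 \<Rightarrow> 'a l2 \<Rightarrow> 'a l2" is "\<lambda>x y n. x n + y n"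
  using square_integrable_add[where M = "count_space (UNIV :: nat set)"]
  by (auto simp: square_integrable_count_space)

lift_definition minus_l2 :: "'a l2 \<Rightarrow> 'a l2 \<Rightarrow> 'a l2" is "\<lambda>x y n. x n - y n"
  using square_integrable_diff[where M = "count_space (UNIV :: nat set)"]
  by (auto simp: square_integrable_count_space)

lift_definition uminus_l2 :: "'a l2 \<Rightarrow> 'a l2" is "\<lambda>x n. - x n" by simp

lift_definition scaleR_l2 :: "real \<Rightarrow> 'a l2 \<Rightarrow> 'a l2" is "\<lambda>r x n. r *\<^sub>R x n"
  by (simp add: power_mult_distrib summable_mult)

instance
proof
  fix x y z :: "'a l2" and r s :: real
  show "x + y + z = x + (y + z)" by transfer (simp add: add.assoc)
  show "x + y = y + x" by transfer (simp add: add.commute)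
  show "0 + x = x" by transfer simp
  show "- x + x = 0" by transfer simp
  show "x - y = x + - y" by transfer simp
  show "r *\<^sub>R (x + y) = r *\<^sub>R x + r *\<^sub>R y" by transfer (simp add: scaleR_add_right)
  show "(r + s) *\<^sub>R x = r *\<^sub>R x + s *\<^sub>R x" by transfer (simp add: scaleR_add_left)
  show "r *\<^sub>R s *\<^sub>R x = (r * s) *\<^sub>R x" by transfer simp
  show "1 *\<^sub>R x = x" by transfer simp
qed

end

instantiation l2 :: ("{real_normed_field, euclidean_space}") real_normed_vector
begin

lift_definition norm_l2 :: "'a l2 \<Rightarrow> real" is "\<lambda>x. sqrt (\<Sum>n. (norm (x n))\<^sup>2)" .

definition sgn_l2 :: "'a l2 \<Rightarrow> 'a l2" where "sgn_l2 x = x /\<^sub>R norm x"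

definition dist_l2 :: "'a l2 \<Rightarrow> 'a l2 \<Rightarrow> real" where "dist_l2 x y = norm (x - y)"

definition uniformity_l2 :: "('a l2 \<times> 'a l2) filter"
  where "uniformity_l2 = (INF e\<in>{0<..}. principal {(x, y). dist x y < e})"

definition open_l2 :: "'a l2 set \<Rightarrow> bool"
  where "open_l2 U \<longleftrightarrow> (\<forall>x\<in>U. eventually (\<lambda>(x', y). x' = x \<longrightarrow> y \<in> U) uniformity)"

instance
proof
  fix x y z :: "'a l2" and r s :: real
  show "sgn x = x /\<^sub>R norm x" by (rule sgn_l2_def)
  show "dist x y = norm (x - y)" by (rule dist_l2_def)
  show "uniformity = (INF e\<in>{0<..}. principal {(x, y::'a l2). dist x y < e})"
    by (rule uniformity_l2_def)
  show "open U \<longleftrightarrow> (\<forall>x\<in>U. eventually (\<lambda>(x', y). x' = x \<longrightarrow> y \<in> U) uniformity)"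
    for U :: "'a l2 set"
    by (rule open_l2_def)
  show "norm x = 0 \<longleftrightarrow> x = 0"
    by transfer (auto simp: suminf_eq_zero_iff fun_eq_iff)
  show "norm (x + y) \<le> norm x + norm y"
  proof transfer
    fix x y :: "nat \<Rightarrow> 'a"
    assume "summable (\<lambda>n. (norm (x n))\<^sup>2)" "summable (\<lambda>n. (norm (y n))\<^sup>2)"
    then show "sqrt (\<Sum>n. (norm (x n + y n))\<^sup>2)
        \<le> sqrt (\<Sum>n. (norm (x n))\<^sup>2) + sqrt (\<Sum>n. (norm (y n))\<^sup>2)"
      using norm2_triangle[of x "count_space UNIV" y] square_integrable_add[of x "count_space UNIV" y]
      by (simp add: square_integrable_count_space norm2_count_space)
  qed
  show "norm (r *\<^sub>R x) = \<bar>r\<bar> * norm x"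
    by transfer (simp add: power_mult_distrib suminf_mult real_sqrt_mult)
qed

end

instantiation l2 :: ("{real_normed_field, euclidean_space}") ordered_real_vector
begin

lift_definition less_eq_l2 :: "'a l2 \<Rightarrow> 'a l2 \<Rightarrow> bool" is "\<lambda>x y. \<forall>n. y n - x n \<in> \<real>\<^sub>\<ge>\<^sub>0" .

definition less_l2 :: "'a l2 \<Rightarrow> 'a l2 \<Rightarrow> bool" where "less_l2 x y \<longleftrightarrow> x \<le> y \<and> \<not> y \<le> x"

instance
proof
  fix x y z :: "'a l2" and r s :: real
  show "(x < y) = (x \<le> y \<and> \<not> y \<le> x)" by (rule less_l2_def)
  show "x \<le> x" by transfer simp
  show "x \<le> z" if "x \<le> y" "y \<le> z"
    using that
  proof transfer
    fix x y z :: "nat \<Rightarrow> 'a"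
    assume *: "\<forall>n. y n - x n \<in> \<real>\<^sub>\<ge>\<^sub>0" "\<forall>n. z n - y n \<in> \<real>\<^sub>\<ge>\<^sub>0"
    show "\<forall>n. z n - x n \<in> \<real>\<^sub>\<ge>\<^sub>0"
    proof
      fix n
      show "z n - x n \<in> \<real>\<^sub>\<ge>\<^sub>0" using nonneg_Reals_add_I[of "y n - x n" "z n - y n"] * by simp
    qed
  qed
  show "x = y" if "x \<le> y" "y \<le> x"
    using that
  proof transfer
    fix x y :: "nat \<Rightarrow> 'a"
    assume *: "\<forall>n. y n - x n \<in> \<real>\<^sub>\<ge>\<^sub>0" "\<forall>n. x n - y n \<in> \<real>\<^sub>\<ge>\<^sub>0"
    show "x = y"
    proof
      fix n
      show "x n = y n" using nonneg_Reals_antisym[of "x n - y n"] * by simp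
    qed
  qed
  show "z + x \<le> z + y" if "x \<le> y" using that by transfer simp
  show "r *\<^sub>R x \<le> r *\<^sub>R y" if "x \<le> y" "0 \<le> r"
    using that by transfer (simp add: scaleR_diff_right[symmetric] nonneg_Reals_scaleR)
  show "r *\<^sub>R x \<le> s *\<^sub>R x" if "r \<le> s" "0 \<le> x"
    using that by transfer (simp add: scaleR_diff_left[symmetric] nonneg_Reals_scaleR)
qed

end

lift_definition scale_l2 :: "'k \<Rightarrow> 'k l2 \<Rightarrow> 'k::{real_normed_field, euclidean_space} l2"
  is "\<lambda>c x n. c * x n"
  by (simp add: norm_mult power_mult_distrib summable_mult)

lemma norm_scale_l2: "norm (scale_l2 c x) = norm c * norm x"
  by transfer (simp add: norm_mult power_mult_distrib suminf_mult real_sqrt_mult)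

lemma scale_l2_of_real: "scale_l2 (of_real r) x = r *\<^sub>R x"
  by transfer (simp add: scaleR_conv_of_real)

lemma vector_space_l2:
  "vector_space (scale_l2 :: 'k \<Rightarrow> _ \<Rightarrow> 'k::{real_normed_field, euclidean_space} l2)"
proof
  fix a b :: 'k and x y :: "'k l2"
  show "scale_l2 a (x + y) = scale_l2 a x + scale_l2 a y" by transfer (simp add: algebra_simps)
  show "scale_l2 (a + b) x = scale_l2 a x + scale_l2 b x" by transfer (simp add: algebra_simps)
  show "scale_l2 a (scale_l2 b x) = scale_l2 (a * b) x" by transfer (simp add: algebra_simps)
  show "scale_l2 1 x = x" by transfer simp
qed

lift_definition basis_l2 :: "nat \<Rightarrow> 'k::{real_normed_field, euclidean_space} l2"
  is "\<lambda>n k. if k = n then 1 else 0"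
  by (rule summable_finite[of "{_}"]) auto


section \<open>Positive operators and super commutants\<close>

text \<open>
  A normed space over \<open>'k\<close> is given by a type of class \<^class>\<open>real_normed_vector\<close> together with a
  scalar multiplication \<open>s :: 'k \<Rightarrow> 'e \<Rightarrow> 'e\<close>.  As \<^typ>\<open>'e \<Rightarrow>\<^sub>L 'e\<close> consists of the bounded
  \<open>\<real>\<close>-linear operators, \<open>'k\<close>-linearity is demanded in addition.
\<close>

definition bounded_operators ::
    "('k::field \<Rightarrow> 'e \<Rightarrow> 'e) \<Rightarrow> ('e::real_normed_vector \<Rightarrow>\<^sub>L 'e) set"
  where "bounded_operators s = {T. Vector_Spaces.linear s s (blinfun_apply T)}"

definition positive_operators ::
    "('k::field \<Rightarrow> 'e \<Rightarrow> 'e) \<Rightarrow> ('e::{real_normed_vector, ordered_real_vector} \<Rightarrow>\<^sub>L 'e) set"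
  where "positive_operators s = {T \<in> bounded_operators s. \<forall>x\<ge>0. blinfun_apply T x \<ge> 0}"

definition super_right_commutant ::
    "('k::field \<Rightarrow> 'e \<Rightarrow> 'e) \<Rightarrow> ('e::{real_normed_vector, ordered_real_vector} \<Rightarrow>\<^sub>L 'e) \<Rightarrow> ('e \<Rightarrow>\<^sub>L 'e) set"
  where "super_right_commutant s A =
    {B \<in> positive_operators s. (B o\<^sub>L A) - (A o\<^sub>L B) \<in> positive_operators s}"

definition super_left_commutant ::
    "('k::field \<Rightarrow> 'e \<Rightarrow> 'e) \<Rightarrow> ('e::{real_normed_vector, ordered_real_vector} \<Rightarrow>\<^sub>L 'e) \<Rightarrow> ('e \<Rightarrow>\<^sub>L 'e) set"
  where "super_left_commutant s A =
    {B \<in> positive_operators s. (A o\<^sub>L B) - (B o\<^sub>L A) \<in> positive_operators s}"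


section \<open>Operator algebras and the radical\<close>

definition scale_operator ::
    "('k::field \<Rightarrow> 'e \<Rightarrow> 'e) \<Rightarrow> 'k \<Rightarrow> ('e::real_normed_vector \<Rightarrow>\<^sub>L 'e) \<Rightarrow> ('e \<Rightarrow>\<^sub>L 'e)"
  where "scale_operator s c T = Blinfun (\<lambda>x. s c (blinfun_apply T x))"

context
  fixes s :: "'k::real_normed_field \<Rightarrow> 'e::real_normed_vector \<Rightarrow> 'e"
  assumes s: "vector_space s"
    and s_of_real: "\<And>r x. s (of_real r) x = r *\<^sub>R x"
    and norm_s: "\<And>c x. norm (s c x) = norm c * norm x"
begin

lemma scale_operator_apply:
  "blinfun_apply (scale_operator s c T) x = s c (blinfun_apply T x)"
proof -
  interpret vector_space s by (rule s)
  have "bounded_linear (\<lambda>x. s c (blinfun_apply T x))"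
  proof (rule bounded_linear_intro[where K = "norm c * norm T"])
    fix x y r
    show "s c (blinfun_apply T (x + y)) = s c (blinfun_apply T x) + s c (blinfun_apply T y)"
      by (simp add: blinfun.add_right scale_right_distrib)
    show "s c (blinfun_apply T (r *\<^sub>R x)) = r *\<^sub>R s c (blinfun_apply T x)"
      unfolding blinfun.scaleR_right by (simp add: s_of_real[symmetric] mult.commute)
    show "norm (s c (blinfun_apply T x)) \<le> norm x * (norm c * norm T)"
      using mult_left_mono[OF norm_blinfun[of T x] norm_ge_zero[of c]]
      by (simp add: norm_s algebra_simps)
  qed
  then show ?thesis by (simp add: scale_operator_def bounded_linear_Blinfun_apply)
qed

lemma vector_space_scale_operator: "vector_space (scale_operator s)"
proof -
  interpret vector_space s by (rule s)
  show ?thesis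
    by standard (auto intro!: blinfun_eqI
        simp: scale_operator_apply blinfun.add_left scale_right_distrib scale_left_distrib)
qed

end

lemma vector_space_scale_operator_L2:
  "vector_space (scale_operator (scale_L2 :: 'k::{real_normed_field, euclidean_space} \<Rightarrow> _))"
  by (rule vector_space_scale_operator[OF vector_space_L2 scale_L2_of_real norm_scale_L2])

lemma vector_space_scale_operator_l2:
  "vector_space (scale_operator (scale_l2 :: 'k::{real_normed_field, euclidean_space} \<Rightarrow> _))"
  by (rule vector_space_scale_operator[OF vector_space_l2 scale_l2_of_real norm_scale_l2])

text \<open>Subalgebras are not required to contain the identity operator.\<close>

definition operator_subalgebra ::
    "('k::field \<Rightarrow> 'e \<Rightarrow> 'e) \<Rightarrow> ('e::real_normed_vector \<Rightarrow>\<^sub>L 'e) set \<Rightarrow> bool"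
  where "operator_subalgebra s A \<longleftrightarrow>
    module.subspace (scale_operator s) A \<and> (\<forall>P\<in>A. \<forall>Q\<in>A. P o\<^sub>L Q \<in> A)"

definition generated_algebra ::
    "('k::field \<Rightarrow> 'e \<Rightarrow> 'e) \<Rightarrow> ('e::real_normed_vector \<Rightarrow>\<^sub>L 'e) set \<Rightarrow> ('e \<Rightarrow>\<^sub>L 'e) set"
  where "generated_algebra s X = \<Inter>{A. operator_subalgebra s A \<and> X \<subseteq> A}"

definition generated_Banach_algebra ::
    "('k::field \<Rightarrow> 'e \<Rightarrow> 'e) \<Rightarrow> ('e::real_normed_vector \<Rightarrow>\<^sub>L 'e) set \<Rightarrow> ('e \<Rightarrow>\<^sub>L 'e) set"
  where "generated_Banach_algebra s X = closure (generated_algebra s X)"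

definition left_ideal_of ::
    "('k::field \<Rightarrow> 'e \<Rightarrow> 'e) \<Rightarrow> ('e::real_normed_vector \<Rightarrow>\<^sub>L 'e) set \<Rightarrow> ('e \<Rightarrow>\<^sub>L 'e) set \<Rightarrow> bool"
  where "left_ideal_of s A J \<longleftrightarrow>
    J \<subseteq> A \<and> module.subspace (scale_operator s) J \<and> (\<forall>a\<in>A. \<forall>j\<in>J. a o\<^sub>L j \<in> J)"

definition modular_left_ideal_of ::
    "('k::field \<Rightarrow> 'e \<Rightarrow> 'e) \<Rightarrow> ('e::real_normed_vector \<Rightarrow>\<^sub>L 'e) set \<Rightarrow> ('e \<Rightarrow>\<^sub>L 'e) set \<Rightarrow> bool"
  where "modular_left_ideal_of s A J \<longleftrightarrow>
    left_ideal_of s A J \<and> (\<exists>u\<in>A. \<forall>a\<in>A. a - (a o\<^sub>L u) \<in> J)"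

definition maximal_modular_left_ideal_of ::
    "('k::field \<Rightarrow> 'e \<Rightarrow> 'e) \<Rightarrow> ('e::real_normed_vector \<Rightarrow>\<^sub>L 'e) set \<Rightarrow> ('e \<Rightarrow>\<^sub>L 'e) set \<Rightarrow> bool"
  where "maximal_modular_left_ideal_of s A J \<longleftrightarrow>
    modular_left_ideal_of s A J \<and> J \<noteq> A \<and>
    (\<forall>K. left_ideal_of s A K \<longrightarrow> J \<subseteq> K \<longrightarrow> K = J \<or> K = A)"

text \<open>The intersection is taken within \<open>A\<close>: it is \<open>A\<close> if there are no such ideals.\<close>

definition radical ::
    "('k::field \<Rightarrow> 'e \<Rightarrow> 'e) \<Rightarrow> ('e::real_normed_vector \<Rightarrow>\<^sub>L 'e) set \<Rightarrow> ('e \<Rightarrow>\<^sub>L 'e) set"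
  where "radical s A = A \<inter> \<Inter>{J. maximal_modular_left_ideal_of s A J}"


section \<open>The Volterra operator\<close>

lemma square_integrable_unit_integrable:
  assumes "f \<in> square_integrable unit_measure"
  shows "integrable unit_measure f"
    and "(\<integral>x. norm (f x) \<partial>unit_measure) \<le> norm2 unit_measure f"
proof -
  have one: "(\<lambda>x. 1 :: real) \<in> square_integrable unit_measure"
    by (simp add: square_integrable_def integrable_restrict_space)
  have norm_one: "norm2 unit_measure (\<lambda>x. 1 :: real) = 1"
    by (simp add: norm2_def measure_restrict_space)
  have f': "(\<lambda>x. norm (f x)) \<in> square_integrable unit_measure"
    using assms by (auto simp: square_integrable_def)
  have "integrable unit_measure (\<lambda>x. norm (norm (f x)) * norm (1::real))"
    by (rule square_integrable_mult_integrable[OF f' one])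
  then show "integrable unit_measure f"
    using assms by (simp add: integrable_norm_iff square_integrable_measurable)
  show "(\<integral>x. norm (f x) \<partial>unit_measure) \<le> norm2 unit_measure f"
    using square_integrable_Cauchy_Schwarz[OF f' one] norm_one
    by (simp add: norm2_def)
qed

lemma unit_integral_restrict:
  fixes f :: "real \<Rightarrow> 'k::{real_normed_field, euclidean_space}"
  assumes f: "integrable unit_measure f" and x: "x \<in> {0..1}"
  shows "integrable (lebesgue_on {0..x}) f"
    and "(\<integral>t. f t \<partial>lebesgue_on {0..x}) = integral {0..x} f"
    and "norm (\<integral>t. f t \<partial>lebesgue_on {0..x}) \<le> (\<integral>t. norm (f t) \<partial>unit_measure)"
proof -
  show int: "integrable (lebesgue_on {0..x}) f"
    using x f by (auto intro: integrable_subinterval)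
  show "(\<integral>t. f t \<partial>lebesgue_on {0..x}) = integral {0..x} f"
    by (rule lebesgue_integral_eq_integral[OF int]) simp
  have "norm (\<integral>t. f t \<partial>lebesgue_on {0..x}) \<le> (\<integral>t. norm (f t) \<partial>lebesgue_on {0..x})"
    by (rule integral_norm_bound)
  also have "\<dots> = integral {0..x} (\<lambda>t. norm (f t))"
    using int by (intro lebesgue_integral_eq_integral) auto
  also have "\<dots> \<le> integral {0..1} (\<lambda>t. norm (f t))"
    using x int f by (intro integral_subset_le) (auto intro!: integrable_on_lebesgue_on)
  also have "\<dots> = (\<integral>t. norm (f t) \<partial>unit_measure)"
    using f by (intro lebesgue_integral_eq_integral[symmetric]) auto
  finally show "norm (\<integral>t. f t \<partial>lebesgue_on {0..x}) \<le> (\<integral>t. norm (f t) \<partial>unit_measure)" .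
qed

lemma volterra_square_integrable:
  fixes f :: "real \<Rightarrow> 'k::{real_normed_field, euclidean_space}"
  assumes f: "f \<in> square_integrable unit_measure"
  shows "(\<lambda>x. \<integral>t. f t \<partial>lebesgue_on {0..x}) \<in> square_integrable unit_measure" (is "?F \<in> _")
    and "norm2 unit_measure (\<lambda>x. \<integral>t. f t \<partial>lebesgue_on {0..x}) \<le> norm2 unit_measure f"
proof -
  note fi = square_integrable_unit_integrable[OF f]
  have "f integrable_on {0..1}"
    using fi(1) by (intro integrable_on_lebesgue_on) auto
  then have "continuous_on {0..1} (\<lambda>x. integral {0..x} f)"
    by (rule indefinite_integral_continuous_1)
  then have "continuous_on {0..1} ?F"
    by (rule continuous_on_eq) (simp add: unit_integral_restrict(2)[OF fi(1)])
  then have F [measurable]: "?F \<in> borel_measurable unit_measure"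
    by (rule continuous_imp_measurable_on_sets_lebesgue) simp
  have bound': "norm (?F x) \<le> norm2 unit_measure f" if "0 \<le> x" "x \<le> 1" for x
    using unit_integral_restrict(3)[OF fi(1), of x] fi(2) that by simp
  have bound: "(norm (?F x))\<^sup>2 \<le> (norm2 unit_measure f)\<^sup>2" if "x \<in> {0..1}" for x
    using bound' that by (intro power_mono) auto
  have const: "integrable unit_measure (\<lambda>x. (norm2 unit_measure f)\<^sup>2)"
    by (simp add: integrable_restrict_space)
  have int: "integrable unit_measure (\<lambda>x. (norm (?F x))\<^sup>2)"
    by (rule Bochner_Integration.integrable_bound[OF const]) (use F bound' in \<open>auto intro!: AE_I2\<close>)
  with F show "?F \<in> square_integrable unit_measure" by (simp add: square_integrable_def)
  have "(norm2 unit_measure ?F)\<^sup>2 \<le> (\<integral>x. (norm2 unit_measure f)\<^sup>2 \<partial>unit_measure)"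
    unfolding norm2_square[of _ ?F] using int const
    by (rule integral_mono) (use bound in simp)
  also have "\<dots> = (norm2 unit_measure f)\<^sup>2" by (simp add: measure_restrict_space)
  finally show "norm2 unit_measure ?F \<le> norm2 unit_measure f"
    by (rule power2_le_imp_le) simp
qed

lift_definition volterra_map :: "'k L2 \<Rightarrow> 'k::{real_normed_field, euclidean_space} L2"
  is "\<lambda>f x. \<integral>t. f t \<partial>lebesgue_on {0..x}"
proof -
  fix f g :: "real \<Rightarrow> 'k"
  assume fg: "L2_rel f g"
  have d: "(\<lambda>x. f x - g x) \<in> square_integrable unit_measure"
    using fg by (auto simp: L2_rel_def square_integrable_diff)
  have ae: "AE x in unit_measure. f x - g x = 0" using fg by (auto simp: L2_rel_def)
  have "(\<integral>x. norm (f x - g x) \<partial>unit_measure) = 0"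
    using ae by (intro integral_eq_zero_AE) (auto elim: eventually_mono)
  moreover have "integrable unit_measure f" "integrable unit_measure g"
    using fg by (auto simp: L2_rel_def square_integrable_unit_integrable)
  ultimately have "(\<integral>t. f t \<partial>lebesgue_on {0..x}) = (\<integral>t. g t \<partial>lebesgue_on {0..x})"
    if x: "x \<in> {0..1}" for x
  proof -
    assume *: "(\<integral>x. norm (f x - g x) \<partial>unit_measure) = 0"
      and f: "integrable unit_measure f" and g: "integrable unit_measure g"
    have "(\<integral>t. f t \<partial>lebesgue_on {0..x}) - (\<integral>t. g t \<partial>lebesgue_on {0..x})
        = (\<integral>t. f t - g t \<partial>lebesgue_on {0..x})"
      by (rule Bochner_Integration.integral_diff[symmetric]; rule unit_integral_restrict(1)[OF _ x])
        (fact f g)+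
    also have "\<dots> = 0"
      using unit_integral_restrict(3)[OF square_integrable_unit_integrable(1)[OF d] x] * by simp
    finally show ?thesis by simp
  qed
  then have "AE x in unit_measure. (\<integral>t. f t \<partial>lebesgue_on {0..x}) = (\<integral>t. g t \<partial>lebesgue_on {0..x})"
    by (intro AE_I2) simp
  with fg show "L2_rel (\<lambda>x. \<integral>t. f t \<partial>lebesgue_on {0..x}) (\<lambda>x. \<integral>t. g t \<partial>lebesgue_on {0..x})"
    by (simp add: L2_rel_def volterra_square_integrable(1))
qed

lift_definition volterra :: "'k L2 \<Rightarrow>\<^sub>L 'k::{real_normed_field, euclidean_space} L2"
  is volterra_map
proof (rule bounded_linear_intro[where K = 1])
  fix f g :: "'k L2" and r :: real
  show "volterra_map (f + g) = volterra_map f + volterra_map g"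
  proof transfer
    fix f g :: "real \<Rightarrow> 'k"
    assume "L2_rel f f" "L2_rel g g"
    then show "L2_rel (\<lambda>x. \<integral>t. f t + g t \<partial>lebesgue_on {0..x})
        (\<lambda>x. (\<integral>t. f t \<partial>lebesgue_on {0..x}) + (\<integral>t. g t \<partial>lebesgue_on {0..x}))"
      by (auto simp: L2_rel_def square_integrable_unit_integrable unit_integral_restrict(1)
          intro!: volterra_square_integrable(1) square_integrable_add AE_I2 Bochner_Integration.integral_add)
  qed
  show "volterra_map (r *\<^sub>R f) = r *\<^sub>R volterra_map f"
    by transfer (auto simp: L2_rel_def intro!: square_integrable_scaleR volterra_square_integrable(1))
  show "norm (volterra_map f) \<le> norm f * 1"
    by transfer (simp add: L2_rel_def volterra_square_integrable(2))
qed


section \<open>Donoghue operators\<close>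

text \<open>
  The operator with \<open>S e\<^sub>0 = 0\<close> and \<open>S e\<^sub>n = w\<^sub>n e\<^sub>n\<^sub>-\<^sub>1\<close> has coordinates \<open>(S x)\<^sub>n = w\<^sub>n\<^sub>+\<^sub>1 x\<^sub>n\<^sub>+\<^sub>1\<close>.
  The value \<open>w 0\<close> is not used.  For unbounded \<open>w\<close> the definition is meaningless.
\<close>

definition donoghue :: "(nat \<Rightarrow> real) \<Rightarrow> ('k l2 \<Rightarrow>\<^sub>L 'k::{real_normed_field, euclidean_space} l2)"
  where "donoghue w =
    Blinfun (\<lambda>x. Abs_l2 (\<lambda>n. of_real (w (Suc n)) * Rep_l2 x (Suc n)))"

lemma donoghue_bounded:
  fixes x :: "nat \<Rightarrow> 'k::{real_normed_field, euclidean_space}"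
  assumes w: "\<And>n. \<bar>w (Suc n)\<bar> \<le> C" and x: "summable (\<lambda>n. (norm (x n))\<^sup>2)"
  shows "summable (\<lambda>n. (norm (of_real (w (Suc n)) * x (Suc n)))\<^sup>2)"
    and "(\<Sum>n. (norm (of_real (w (Suc n)) * x (Suc n)))\<^sup>2) \<le> C\<^sup>2 * (\<Sum>n. (norm (x n))\<^sup>2)"
proof -
  have le: "(norm (of_real (w (Suc n)) * x (Suc n)))\<^sup>2 \<le> C\<^sup>2 * (norm (x (Suc n)))\<^sup>2" for n
    using power_mono[OF w[of n], of 2]
    by (simp add: norm_mult power_mult_distrib mult_right_mono)
  have xs: "summable (\<lambda>n. (norm (x (Suc n)))\<^sup>2)"
    using x by (subst summable_Suc_iff)
  then show s: "summable (\<lambda>n. (norm (of_real (w (Suc n)) * x (Suc n)))\<^sup>2)"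
    by (intro summable_comparison_test'[OF summable_mult[OF xs]]) (use le in auto)
  have "(\<Sum>n. (norm (of_real (w (Suc n)) * x (Suc n)))\<^sup>2) \<le> (\<Sum>n. C\<^sup>2 * (norm (x (Suc n)))\<^sup>2)"
    by (rule suminf_le[OF le s summable_mult[OF xs]])
  also have "\<dots> = C\<^sup>2 * (\<Sum>n. (norm (x (Suc n)))\<^sup>2)" by (rule suminf_mult[OF xs])
  also have "\<dots> \<le> C\<^sup>2 * (\<Sum>n. (norm (x n))\<^sup>2)"
    using suminf_split_head[OF x] by (intro mult_left_mono) auto
  finally show "(\<Sum>n. (norm (of_real (w (Suc n)) * x (Suc n)))\<^sup>2) \<le> C\<^sup>2 * (\<Sum>n. (norm (x n))\<^sup>2)" .
qed

lemma donoghue_apply: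
  assumes w: "\<And>n. \<bar>w (Suc n)\<bar> \<le> C"
  shows "Rep_l2 (blinfun_apply (donoghue w) x) n = of_real (w (Suc n)) * Rep_l2 x (Suc n)"
proof -
  let ?D = "\<lambda>x :: 'a l2. Abs_l2 (\<lambda>n. of_real (w (Suc n)) * Rep_l2 x (Suc n))"
  have D: "Rep_l2 (?D x) = (\<lambda>n. of_real (w (Suc n)) * Rep_l2 x (Suc n))" for x
    using donoghue_bounded(1)[where w = w, OF w] Rep_l2[of x] by (intro Abs_l2_inverse) auto
  have C: "C \<ge> 0" using w[of 0] by simp
  have "bounded_linear ?D"
  proof (rule bounded_linear_intro[where K = C])
    fix x y r
    show "?D (x + y) = ?D x + ?D y"
      unfolding Rep_l2_inject[symmetric] plus_l2.rep_eq[of "?D x"] D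
      by (simp add: plus_l2.rep_eq distrib_left)
    show "?D (r *\<^sub>R x) = r *\<^sub>R ?D x"
      unfolding Rep_l2_inject[symmetric] scaleR_l2.rep_eq[of _ "?D x"] D
      by (simp add: scaleR_l2.rep_eq)
    have "norm (?D x) \<le> sqrt (C\<^sup>2 * (\<Sum>n. (norm (Rep_l2 x n))\<^sup>2))"
      unfolding norm_l2.rep_eq D using donoghue_bounded(2)[where w = w, OF w, of "Rep_l2 x"] Rep_l2[of x]
      by (intro real_sqrt_le_mono) auto
    also have "\<dots> = norm x * C" using C by (simp add: norm_l2.rep_eq real_sqrt_mult)
    finally show "norm (?D x) \<le> norm x * C" .
  qed
  then show ?thesis by (simp add: donoghue_def bounded_linear_Blinfun_apply D)
qed

lemma donoghue_basis:
  assumes "\<And>n. \<bar>w (Suc n)\<bar> \<le> C"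
  shows "blinfun_apply (donoghue w) (basis_l2 0) = 0"
    and "blinfun_apply (donoghue w) (basis_l2 (Suc n)) = w (Suc n) *\<^sub>R basis_l2 n"
  by (auto simp: Rep_l2_inject[symmetric] fun_eq_iff donoghue_apply[where w = w, OF assms]
      basis_l2.rep_eq zero_l2.rep_eq scaleR_l2.rep_eq scaleR_conv_of_real)

end

theory Submission
  imports Defs
begin

text \<open>
  Both operators are strictly triangular with respect to a nest of closed ideals: \<open>V\<close> leaves every
  \<open>L\<^sup>2[a,1]\<close> invariant, and \<open>S\<close> the span of \<open>e\<^sub>0, \<dots>, e\<^sub>n\<close> for every \<open>n\<close>.  The proof rests on two facts.

  First, every operator in a super commutant leaves the same nest invariant
  (\<open>volterra_super_commutants_subset_nest_algebra\<close>,
  \<open>donoghue_super_commutants_subset_nest_algebra\<close>).  The defining inequality for \<open>B\<close> iterates to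
  \<open>V\<^sup>n B \<le> B V\<^sup>n\<close> or \<open>B V\<^sup>n \<le> V\<^sup>n B\<close>.  In the first case \<open>V\<^sup>n B f \<le> B V\<^sup>n f\<close> for \<open>f \<ge> 0\<close>, and the rate at which
  \<open>V\<^sup>n f\<close> decays determines the left end of the support of \<open>f\<close>, so that it cannot move to the left under
  \<open>B\<close>.  In the second case a bounded \<open>f\<close> is dominated by \<open>V\<^sup>n h\<close> for suitable \<open>h\<close>, so that \<open>B f \<le> V\<^sup>n B h\<close>, and the right-hand
  side becomes small to the left of the support.  For \<open>S\<close> the same two ideas are applied to the basis
  vectors.

  Second, write \<open>V\<close> for either operator and let \<open>b\<close> be any bounded operator that leaves the nest invariant.  A finite partition of the
  nest makes \<open>b V\<close> block triangular, and refining the partition makes the diagonal blocks of \<open>V\<close>, hence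
  those of \<open>b V\<close>, as small as desired.  Therefore \<open>b V\<close> is quasinilpotent; more precisely, its powers have
  summable norms (\<open>summable_power_of_small_diagonal_blocks\<close>).  The operators that leave the nest
  invariant form a closed algebra, so they include the generated Banach algebra \<open>A\<close>, and positivity is
  no longer involved.  Since \<open>r = \<Sum>(b V)\<^sup>n\<close>, summed over \<open>n \<ge> 1\<close>, satisfies \<open>r - r b V = b V\<close> and lies in \<open>A\<close> for \<open>b\<close>
  in the unitization of \<open>A\<close>, the operator \<open>V\<close> belongs to every maximal modular left ideal
  (\<open>mem_radicalI\<close>, \<open>radical_of_small_diagonal\<close>).  The series converges because \<open>L\<^sup>2[0,1]\<close> and \<open>l\<^sup>2\<close>, and with
  them the spaces of bounded operators, are complete (\<open>square_integrable_complete\<close>).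
\<close>

section \<open>Operators that are block triangular with small diagonal blocks\<close>

lemmas blinfun_algebra =
  blinfun.add_left blinfun.add_right blinfun.diff_left blinfun.diff_right
  blinfun.zero_left blinfun.zero_right

lemma blinfun_eq_iff: "S = T \<longleftrightarrow> (\<forall>x. blinfun_apply S x = blinfun_apply T x)"
  by (auto intro: blinfun_eqI)

lemma blinfun_compose_assoc: "(R o\<^sub>L S) o\<^sub>L T = R o\<^sub>L (S o\<^sub>L T)"
  by (rule blinfun_eqI) simp

lemma blinfun_compose_id [simp]: "id_blinfun o\<^sub>L T = T" "T o\<^sub>L id_blinfun = T"
  by (auto intro: blinfun_eqI)

definition blinfun_power :: "('e::real_normed_vector \<Rightarrow>\<^sub>L 'e) \<Rightarrow> nat \<Rightarrow> 'e \<Rightarrow>\<^sub>L 'e"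
  where "blinfun_power T n = ((o\<^sub>L) T ^^ n) id_blinfun"

lemma blinfun_power_0 [simp]: "blinfun_power T 0 = id_blinfun"
  by (simp add: blinfun_power_def)

lemma blinfun_power_Suc: "blinfun_power T (Suc n) = T o\<^sub>L blinfun_power T n"
  by (simp add: blinfun_power_def)

lemma blinfun_power_Suc_apply [simp]:
  "blinfun_apply (blinfun_power T (Suc n)) x = T (blinfun_power T n x)"
  by (simp add: blinfun_power_Suc)

lemma blinfun_power_Suc_right: "blinfun_power T (Suc n) = blinfun_power T n o\<^sub>L T"
  by (induction n) (auto intro!: blinfun_eqI simp: blinfun_eq_iff)

text \<open>
  Summing the inequalities \<open>u\<^sub>n\<^sub>+\<^sub>1 \<le> y u\<^sub>n + z\<^sub>n\<close> bounds the partial sums \<open>U\<close> of \<open>u\<close> by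
  \<open>U \<le> u\<^sub>0 + y U + \<Sum>z\<close>, which can be solved for \<open>U\<close> because \<open>y < 1\<close>.
\<close>

lemma summable_of_contracting_recursion:
  fixes u z :: "nat \<Rightarrow> real"
  assumes u: "\<And>n. 0 \<le> u n" and z: "\<And>n. 0 \<le> z n" "summable z" and y: "y < 1"
    and rec: "\<And>n. u (Suc n) \<le> y * u n + z n"
  shows "summable u"
proof (rule summableI_nonneg_bounded[where x = "(u 0 + suminf z) / (1 - y)"])
  fix N
  have "sum u {..<N} \<le> sum u {..<Suc N}" using u by simp
  also have "\<dots> = u 0 + (\<Sum>n<N. u (Suc n))" by (rule sum.lessThan_Suc_shift)
  also have "\<dots> \<le> u 0 + (\<Sum>n<N. y * u n + z n)" by (intro add_left_mono sum_mono rec)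
  also have "\<dots> = u 0 + y * sum u {..<N} + sum z {..<N}"
    by (simp add: sum.distrib sum_distrib_left)
  also have "sum z {..<N} \<le> suminf z" by (rule sum_le_suminf) (use z in auto)
  finally show "sum u {..<N} \<le> (u 0 + suminf z) / (1 - y)"
    using y by (simp add: field_simps)
qed (rule u)

text \<open>
  The spectral radius of a block triangular operator is the largest one of its diagonal blocks; for
  strictly contractive blocks the powers can be summed directly.  With \<open>E = P\<^sub>i\<^sub>+\<^sub>1 - P\<^sub>i\<close>, triangularity
  gives \<open>E T\<^sup>n\<^sup>+\<^sup>1 = (E T E) (E T\<^sup>n) + (E T P\<^sub>i) (P\<^sub>i T\<^sup>n)\<close>: a contracting recursion for
  the \<open>i\<close>-th block row of the powers whose inhomogeneity consists of the earlier block rows.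
\<close>

lemma summable_power_of_small_diagonal_blocks:
  fixes T :: "'e::real_normed_vector \<Rightarrow>\<^sub>L 'e" and P :: "nat \<Rightarrow> 'e \<Rightarrow>\<^sub>L 'e"
  assumes P0: "P 0 = 0" and Pm: "P m = id_blinfun"
    and idem: "\<And>i. i \<le> m \<Longrightarrow> P i o\<^sub>L P i = P i"
    and down: "\<And>i. i < m \<Longrightarrow> P i o\<^sub>L P (Suc i) = P i"
    and up: "\<And>i. i < m \<Longrightarrow> P (Suc i) o\<^sub>L P i = P i"
    and inv: "\<And>i. i \<le> m \<Longrightarrow> P i o\<^sub>L T o\<^sub>L P i = P i o\<^sub>L T"
    and small: "\<And>i. i < m \<Longrightarrow> norm ((P (Suc i) - P i) o\<^sub>L T o\<^sub>L (P (Suc i) - P i)) < 1"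
  shows "summable (\<lambda>n. norm (blinfun_power T n))"
proof -
  have "summable (\<lambda>n. norm (P i o\<^sub>L blinfun_power T n))" if "i \<le> m" for i
    using that
  proof (induction i)
    case 0
    then show ?case by (simp add: P0)
  next
    case (Suc i)
    define E where "E = P (Suc i) - P i"
    define u where "u n = E o\<^sub>L blinfun_power T n" for n
    define z where "z n = (E o\<^sub>L T o\<^sub>L P i) o\<^sub>L (P i o\<^sub>L blinfun_power T n)" for n
    have IH: "summable (\<lambda>n. norm (P i o\<^sub>L blinfun_power T n))" using Suc by simp
    note pw = idem[of i] idem[of "Suc i"] down[of i] up[of i] inv[of i] inv[of "Suc i"]
    have app: "P i (P i x) = P i x" "P i (P (Suc i) x) = P i x"
      "P (Suc i) (P i x) = P i x" "P (Suc i) (P (Suc i) x) = P (Suc i) x"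
      "P i (T (P i x)) = P i (T x)"
      "P (Suc i) (T (P (Suc i) x)) = P (Suc i) (T x)" for x
      using pw Suc.prems by (auto simp: blinfun_eq_iff)
    have split: "P (Suc i) o\<^sub>L blinfun_power T n = (P i o\<^sub>L blinfun_power T n) + u n" for n
      by (rule blinfun_eqI) (simp add: u_def E_def blinfun_algebra)
    have ET: "E (T x) = E (T (E x)) + E (T (P i x))" for x
      using app(5)[of "P (Suc i) x"] app(2,5,6)[of x] by (simp add: E_def blinfun_algebra)
    have EE: "E (E x) = E x" for x
      by (simp add: E_def blinfun_algebra app)
    have step: "u (Suc n) = ((E o\<^sub>L T o\<^sub>L E) o\<^sub>L u n) + z n" for n
    proof (rule blinfun_eqI)
      fix x
      let ?v = "blinfun_power T n x"
      show "u (Suc n) x = (((E o\<^sub>L T o\<^sub>L E) o\<^sub>L u n) + z n) x"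
        using ET[of ?v] app(1)[of ?v] EE[of ?v] by (simp add: u_def z_def blinfun_algebra)
    qed
    have "summable (\<lambda>n. norm (u n))"
    proof (rule summable_of_contracting_recursion)
      have "summable (\<lambda>n. norm (E o\<^sub>L T o\<^sub>L P i) * norm (P i o\<^sub>L blinfun_power T n))"
        by (rule summable_mult[OF IH])
      then show "summable (\<lambda>n. norm (z n))"
        by (rule summable_comparison_test') (auto simp: z_def norm_blinfun_compose)
      show "norm (E o\<^sub>L T o\<^sub>L E) < 1" using small[of i] Suc.prems by (simp add: E_def)
      show "norm (u (Suc n)) \<le> norm (E o\<^sub>L T o\<^sub>L E) * norm (u n) + norm (z n)" for n
        unfolding step by (intro norm_triangle_le add_mono norm_blinfun_compose order_refl)
    qed auto
    with IH have "summable (\<lambda>n. norm (P i o\<^sub>L blinfun_power T n) + norm (u n))"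
      by (rule summable_add)
    then show ?case
      by (rule summable_comparison_test') (auto simp: split norm_triangle_ineq)
  qed
  from this[of m] show ?thesis by (simp add: Pm)
qed


section \<open>Nest algebras and the radical\<close>

locale operator_space =
  fixes s :: "'k::real_normed_field \<Rightarrow> 'e::banach \<Rightarrow> 'e"
  assumes vs: "vector_space s"
    and s_of_real: "\<And>r x. s (of_real r) x = r *\<^sub>R x"
    and norm_s: "\<And>c x. norm (s c x) = norm c * norm x"
begin

sublocale vector_space s by (rule vs)

sublocale op: vector_space "scale_operator s"
  by (rule vector_space_scale_operator[OF vs s_of_real norm_s])

lemma scale_operator_app [simp]:
  "blinfun_apply (scale_operator s c T) x = s c (blinfun_apply T x)"
  by (rule scale_operator_apply[OF vs s_of_real norm_s])

lemma bounded_linear_s: "bounded_linear (s c)"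
  by (rule bounded_linear_intro[where K = "norm c"])
    (auto simp: scale_right_distrib norm_s s_of_real[symmetric] mult.commute)

lemma bounded_operators_iff:
  "T \<in> bounded_operators s \<longleftrightarrow> (\<forall>c x. blinfun_apply T (s c x) = s c (blinfun_apply T x))"
  by (auto simp: bounded_operators_def Vector_Spaces.linear_iff vs blinfun.add_right)

lemma bounded_operators_scale:
  "T \<in> bounded_operators s \<Longrightarrow> blinfun_apply T (s c x) = s c (blinfun_apply T x)"
  by (simp add: bounded_operators_iff)

text \<open>
  For idempotents \<open>P\<close> the condition \<open>P B P = P B\<close> says that the kernel of \<open>P\<close> is invariant
  under \<open>B\<close>.
\<close>

definition nest_algebra :: "('e \<Rightarrow>\<^sub>L 'e) set \<Rightarrow> ('e \<Rightarrow>\<^sub>L 'e) set"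
  where "nest_algebra \<P> = {B \<in> bounded_operators s. \<forall>P\<in>\<P>. P o\<^sub>L B o\<^sub>L P = P o\<^sub>L B}"

lemma nest_algebra_subalgebra:
  assumes "\<P> \<subseteq> bounded_operators s"
  shows "operator_subalgebra s (nest_algebra \<P>)"
  unfolding operator_subalgebra_def
proof (intro conjI op.subspaceI ballI)
  show "0 \<in> nest_algebra \<P>" by (simp add: nest_algebra_def bounded_operators_iff)
  fix A B assume A: "A \<in> nest_algebra \<P>" and B: "B \<in> nest_algebra \<P>"
  show "A + B \<in> nest_algebra \<P>"
    using A B by (auto simp: nest_algebra_def bounded_operators_iff blinfun_eq_iff blinfun_algebra
        scale_right_distrib)
  show "A o\<^sub>L B \<in> nest_algebra \<P>"
    unfolding nest_algebra_def
  proof (intro CollectI conjI ballI blinfun_eqI)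
    fix P x assume "P \<in> \<P>"
    then have *: "P (A (P y)) = P (A y)" "P (B (P y)) = P (B y)" for y
      using A B by (auto simp: nest_algebra_def blinfun_eq_iff)
    show "(P o\<^sub>L (A o\<^sub>L B) o\<^sub>L P) x = (P o\<^sub>L (A o\<^sub>L B)) x"
      using *(1)[of "B (P x)"] *(1)[of "B x"] *(2) by simp
  qed (use A B in \<open>auto simp: nest_algebra_def bounded_operators_iff\<close>)
next
  note P = subsetD[OF assms, THEN bounded_operators_scale]
  fix c A assume "A \<in> nest_algebra \<P>"
  then show "scale_operator s c A \<in> nest_algebra \<P>"
    using P by (auto simp: nest_algebra_def bounded_operators_iff blinfun_eq_iff mult.commute)
qed

lemma id_mem_nest_algebra: "id_blinfun \<in> nest_algebra \<P>" if "\<And>P. P \<in> \<P> \<Longrightarrow> P o\<^sub>L P = P"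
  using that by (auto simp: nest_algebra_def bounded_operators_iff blinfun_eq_iff)

lemma closed_nest_algebra: "closed (nest_algebra \<P>)"
proof -
  have "nest_algebra \<P> = (\<Inter>c x. {B. blinfun_apply B (s c x) = s c (blinfun_apply B x)}) \<inter>
      (\<Inter>P\<in>\<P>. {B. P o\<^sub>L B o\<^sub>L P = P o\<^sub>L B})"
    by (auto simp: nest_algebra_def bounded_operators_iff)
  also have "closed \<dots>"
    by (intro closed_Int closed_INT ballI closed_Collect_eq continuous_intros
        bounded_linear.continuous_on[OF bounded_linear_s])
  finally show ?thesis .
qed

lemma generated_algebra_subalgebra: "operator_subalgebra s (generated_algebra s X)"
proof -
  have "op.subspace (generated_algebra s X)"
    unfolding generated_algebra_def
    by (rule op.subspace_Inter) (auto simp: operator_subalgebra_def)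
  then show ?thesis
    by (auto simp: operator_subalgebra_def generated_algebra_def)
qed

lemma generated_subset: "X \<subseteq> generated_Banach_algebra s X"
  using closure_subset[of "generated_algebra s X"]
  by (auto simp: generated_Banach_algebra_def generated_algebra_def)

lemma closed_generated: "closed (generated_Banach_algebra s X)"
  by (simp add: generated_Banach_algebra_def)

lemma generated_minimal:
  assumes "operator_subalgebra s A" "closed A" "X \<subseteq> A"
  shows "generated_Banach_algebra s X \<subseteq> A"
  unfolding generated_Banach_algebra_def
  by (rule closure_minimal) (use assms in \<open>auto simp: generated_algebra_def\<close>)

lemma bounded_linear_scale_operator: "bounded_linear (scale_operator s c)"
proof (rule bounded_linear_intro[where K = "norm c"])
  fix A B :: "'e \<Rightarrow>\<^sub>L 'e" and r
  show "scale_operator s c (A + B) = scale_operator s c A + scale_operator s c B"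
    by (rule op.scale_right_distrib)
  show "scale_operator s c (r *\<^sub>R A) = r *\<^sub>R scale_operator s c A"
    by (rule blinfun_eqI)
      (simp add: blinfun.scaleR_left linear_cmul[OF bounded_linear.linear[OF bounded_linear_s]])
  show "norm (scale_operator s c A) \<le> norm A * norm c"
    by (rule norm_blinfun_bound)
      (auto simp: norm_s mult.assoc mult.left_commute[of _ "norm c"] norm_blinfun
        intro!: mult_left_mono)
qed

lemma generated_Banach_algebra_subalgebra: "operator_subalgebra s (generated_Banach_algebra s X)"
proof -
  define G where "G = generated_algebra s X"
  have G: "op.subspace G" "\<And>P Q. P \<in> G \<Longrightarrow> Q \<in> G \<Longrightarrow> P o\<^sub>L Q \<in> G"
    using generated_algebra_subalgebra[of X] by (auto simp: operator_subalgebra_def G_def)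
  have "op.subspace (closure G)"
  proof (rule op.subspaceI)
    show "0 \<in> closure G" using op.subspace_0[OF G(1)] closure_subset by blast
  next
    fix A B assume "A \<in> closure G" "B \<in> closure G"
    then obtain a b where ab: "\<And>n. a n \<in> G" "a \<longlonglongrightarrow> A" "\<And>n. b n \<in> G" "b \<longlonglongrightarrow> B"
      unfolding closure_sequential by blast
    then show "A + B \<in> closure G"
      unfolding closure_sequential
      by (intro exI[of _ "\<lambda>n. a n + b n"] conjI allI tendsto_add op.subspace_add[OF G(1)])
  next
    fix c A assume "A \<in> closure G"
    then obtain a where a: "\<And>n. a n \<in> G" "a \<longlonglongrightarrow> A"
      unfolding closure_sequential by blast
    then show "scale_operator s c A \<in> closure G"
      unfolding closure_sequential
      by (intro exI[of _ "\<lambda>n. scale_operator s c (a n)"] conjI allI op.subspace_scale[OF G(1)]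
          bounded_linear.tendsto[OF bounded_linear_scale_operator])
  qed
  moreover have "A o\<^sub>L B \<in> closure G" if "A \<in> closure G" "B \<in> closure G" for A B
  proof -
    obtain a b where ab: "\<And>n. a n \<in> G" "a \<longlonglongrightarrow> A" "\<And>n. b n \<in> G" "b \<longlonglongrightarrow> B"
      using \<open>A \<in> closure G\<close> \<open>B \<in> closure G\<close> unfolding closure_sequential by blast
    then show ?thesis
      unfolding closure_sequential
      by (intro exI[of _ "\<lambda>n. a n o\<^sub>L b n"] conjI allI G(2)
          bounded_bilinear.tendsto[OF bounded_bilinear_blinfun_compose])
  qed
  ultimately show ?thesis
    by (auto simp: operator_subalgebra_def generated_Banach_algebra_def G_def)
qed

text \<open>
  Take the Neumann series \<open>r = \<Sum>q\<^sup>n\<close> over \<open>n \<ge> 1\<close>: its partial sums lie in \<open>A\<close>, and \<open>r q\<close> is the same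
  series without the first term.
\<close>

lemma quasi_inverse_exists:
  assumes A: "operator_subalgebra s A" "closed A" and q: "q \<in> A"
    and sum: "summable (\<lambda>n. norm (blinfun_power q n))"
  obtains r where "r \<in> A" "r - (r o\<^sub>L q) = q"
proof
  let ?p = "\<lambda>n. blinfun_power q (Suc n)"
  have sp: "summable ?p"
    using sum by (subst summable_Suc_iff) (rule summable_norm_cancel)
  have pA: "?p n \<in> A" for n
  proof (induction n)
    case 0
    then show ?case using q by (simp add: blinfun_power_Suc)
  next
    case (Suc n)
    then show ?case
      using A(1) q by (subst blinfun_power_Suc) (auto simp: operator_subalgebra_def)
  qed
  have "sum ?p {..<N} \<in> A" for N
    using A(1) pA by (intro op.subspace_sum) (auto simp: operator_subalgebra_def)
  then show "suminf ?p \<in> A"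
    by (rule closed_sequentially[OF A(2) _ summable_LIMSEQ[OF sp]])
  have "(suminf ?p) o\<^sub>L q = (\<Sum>n. ?p n o\<^sub>L q)"
    by (rule bounded_linear.suminf[OF bounded_bilinear.bounded_linear_left[OF bounded_bilinear_blinfun_compose] sp])
  also have "\<dots> = (\<Sum>n. ?p (Suc n))" by (simp only: blinfun_power_Suc_right[symmetric])
  also have "\<dots> = suminf ?p - ?p 0" by (rule suminf_split_head[OF sp])
  finally show "suminf ?p - (suminf ?p o\<^sub>L q) = q"
    by (simp add: blinfun_power_Suc)
qed

text \<open>
  If a maximal modular left ideal \<open>J\<close> with right modular unit \<open>u\<close> missed \<open>V\<close>, then
  \<open>u = j + b V\<close> with \<open>j \<in> J\<close> and \<open>b\<close> in the unitization of \<open>A\<close>.  So \<open>q = b V\<close> is again a right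
  modular unit, and a left quasi-inverse \<open>r\<close> of \<open>q\<close> gives \<open>q = r - r q \<in> J\<close>, whence \<open>u \<in> J\<close>:
  impossible for a proper ideal.
\<close>

lemma mem_radicalI:
  assumes A: "operator_subalgebra s A" "closed A" "A \<subseteq> bounded_operators s" and V: "V \<in> A"
    and nil: "\<And>a c. a \<in> A \<Longrightarrow>
      summable (\<lambda>n. norm (blinfun_power ((a o\<^sub>L V) + scale_operator s c V) n))"
  shows "V \<in> radical s A"
  unfolding radical_def
proof (intro IntI V InterI)
  fix J assume "J \<in> {J. maximal_modular_left_ideal_of s A J}"
  then have JA: "J \<subseteq> A" and Js: "op.subspace J" and Jl: "\<And>a j. a \<in> A \<Longrightarrow> j \<in> J \<Longrightarrow> a o\<^sub>L j \<in> J"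
    and Jm: "\<exists>u\<in>A. \<forall>a\<in>A. a - (a o\<^sub>L u) \<in> J" and Jne: "J \<noteq> A"
    and max: "\<And>K. left_ideal_of s A K \<Longrightarrow> J \<subseteq> K \<Longrightarrow> K = J \<or> K = A"
    by (auto simp: maximal_modular_left_ideal_of_def modular_left_ideal_of_def left_ideal_of_def)
  have As: "op.subspace A" and Am: "\<And>a b. a \<in> A \<Longrightarrow> b \<in> A \<Longrightarrow> a o\<^sub>L b \<in> A"
    using A(1) by (auto simp: operator_subalgebra_def)
  have comp_scale: "a o\<^sub>L scale_operator s c T = scale_operator s c (a o\<^sub>L T)" if "a \<in> A" for a c T
    using that A(3) by (auto intro!: blinfun_eqI simp: bounded_operators_scale)
  have scale_comp: "scale_operator s c (a o\<^sub>L T) = scale_operator s c a o\<^sub>L T" for a c T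
    by (rule blinfun_eqI) simp
  note comp_add = bounded_bilinear.add_right[OF bounded_bilinear_blinfun_compose]
    bounded_bilinear.add_left[OF bounded_bilinear_blinfun_compose]
    bounded_bilinear.diff_right[OF bounded_bilinear_blinfun_compose]
  obtain u where u: "u \<in> A" "\<And>a. a \<in> A \<Longrightarrow> a - (a o\<^sub>L u) \<in> J" using Jm by blast
  show "V \<in> J"
  proof (rule ccontr)
    assume "V \<notin> J"
    \<comment> \<open>the left ideal generated by \<open>J\<close> and \<open>V\<close>; the scalar multiples of \<open>V\<close> are listed separately
      because \<open>A\<close> may lack a unit\<close>
    define K where "K = {j + (a o\<^sub>L V) + scale_operator s c V | j a c. j \<in> J \<and> a \<in> A}"
    have KI: "j + (a o\<^sub>L V) + scale_operator s c V \<in> K" if "j \<in> J" "a \<in> A" for j a c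
      using that by (auto simp: K_def)
    have "left_ideal_of s A K"
      unfolding left_ideal_of_def
    proof (intro conjI op.subspaceI ballI)
      show "K \<subseteq> A"
        using JA V by (auto simp: K_def intro!: op.subspace_add[OF As] op.subspace_scale[OF As] Am)
      show "0 \<in> K"
        using KI[OF op.subspace_0[OF Js] op.subspace_0[OF As], of 0] by simp
    next
      fix x y assume "x \<in> K" "y \<in> K"
      then obtain j a c j' a' c' where x: "x = j + (a o\<^sub>L V) + scale_operator s c V"
        and y: "y = j' + (a' o\<^sub>L V) + scale_operator s c' V"
        and mem: "j \<in> J" "a \<in> A" "j' \<in> J" "a' \<in> A"
        by (auto simp: K_def)
      have "(j + j') + ((a + a') o\<^sub>L V) + scale_operator s (c + c') V \<in> K"
        using mem by (intro KI op.subspace_add[OF Js] op.subspace_add[OF As])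
      then show "x + y \<in> K" by (simp add: x y comp_add op.scale_left_distrib algebra_simps)
    next
      fix d x assume "x \<in> K"
      then obtain j a c where x: "x = j + (a o\<^sub>L V) + scale_operator s c V"
        and mem: "j \<in> J" "a \<in> A"
        by (auto simp: K_def)
      have "scale_operator s d j + (scale_operator s d a o\<^sub>L V) + scale_operator s (d * c) V \<in> K"
        using mem by (intro KI op.subspace_scale[OF Js] op.subspace_scale[OF As])
      then show "scale_operator s d x \<in> K"
        by (simp add: x op.scale_right_distrib scale_comp)
    next
      fix b x assume b: "b \<in> A" and "x \<in> K"
      then obtain j a c where x: "x = j + (a o\<^sub>L V) + scale_operator s c V"
        and mem: "j \<in> J" "a \<in> A"
        by (auto simp: K_def)
      have "(b o\<^sub>L j) + (((b o\<^sub>L a) + scale_operator s c b) o\<^sub>L V) + scale_operator s 0 V \<in> K"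
        using mem b
        by (intro KI Jl op.subspace_add[OF As] op.subspace_scale[OF As] Am)
      then show "b o\<^sub>L x \<in> K"
        by (simp add: x comp_add comp_scale[OF b] scale_comp blinfun_compose_assoc add.assoc)
    qed
    moreover have "J \<subseteq> K"
      using KI[OF _ op.subspace_0[OF As], of _ 0] by auto
    moreover have "V \<in> K"
      using KI[OF op.subspace_0[OF Js] op.subspace_0[OF As], of 1] by simp
    ultimately have "u \<in> K" using max \<open>V \<notin> J\<close> u(1) by blast
    then obtain j a c where uj: "u = j + (a o\<^sub>L V) + scale_operator s c V"
      and j: "j \<in> J" and a: "a \<in> A"
      unfolding K_def by blast
    define q where "q = (a o\<^sub>L V) + scale_operator s c V"
    have qA: "q \<in> A"
      using a V by (auto simp: q_def intro!: op.subspace_add[OF As] op.subspace_scale[OF As] Am)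
    obtain r where r: "r \<in> A" "r - (r o\<^sub>L q) = q"
      using quasi_inverse_exists[OF A(1,2) qA] nil[OF a, of c, folded q_def] by blast
    have uq: "u = j + q" by (simp add: uj q_def add.assoc)
    have "r - (r o\<^sub>L q) = (r - (r o\<^sub>L u)) + (r o\<^sub>L j)"
      by (rule blinfun_eqI) (simp add: uq blinfun_algebra)
    also have "\<dots> \<in> J" by (intro op.subspace_add[OF Js] u(2) Jl r(1) j)
    finally have "q \<in> J" using r(2) by simp
    then have "u \<in> J"
      using op.subspace_add[OF Js j] by (simp add: uq)
    then have "x \<in> J" if "x \<in> A" for x
      using op.subspace_add[OF Js u(2)[OF that] Jl[OF that \<open>u \<in> J\<close>]] by simp
    with JA Jne show False by blast
  qed
qed

text \<open>
  Compression to a diagonal block is multiplicative on a nest algebra, so if the blocks \<open>E V E\<close> have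
  norm at most \<open>\<epsilon>\<close>, those of \<open>b V\<close> have norm at most \<open>\<epsilon> \<parallel>b\<parallel>\<close>, for all \<open>b\<close> in the nest algebra.  The
  nest algebra contains the unitization of the algebra generated by \<open>X\<close>, and \<open>\<epsilon>\<close> may be chosen depending on \<open>b\<close>: the
  powers of \<open>b V\<close> are summable.
\<close>

theorem radical_of_small_diagonal:
  assumes P: "\<P> \<subseteq> bounded_operators s" "\<And>P. P \<in> \<P> \<Longrightarrow> P o\<^sub>L P = P"
    and X: "X \<subseteq> nest_algebra \<P>" and V: "V \<in> X"
    and chain: "\<And>\<epsilon>. \<epsilon> > 0 \<Longrightarrow> \<exists>P m. P 0 = 0 \<and> P m = id_blinfun \<and> (\<forall>i\<le>m. P i \<in> \<P>) \<and>
      (\<forall>i<m. P i o\<^sub>L P (Suc i) = P i \<and> P (Suc i) o\<^sub>L P i = P i \<and> norm (P (Suc i) - P i) \<le> 1 \<and>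
        norm ((P (Suc i) - P i) o\<^sub>L V o\<^sub>L (P (Suc i) - P i)) < \<epsilon>)"
  shows "V \<in> radical s (generated_Banach_algebra s X)"
proof (rule mem_radicalI[OF generated_Banach_algebra_subalgebra closed_generated])
  note sub = nest_algebra_subalgebra[OF P(1)]
  have gen: "generated_Banach_algebra s X \<subseteq> nest_algebra \<P>"
    by (rule generated_minimal[OF sub closed_nest_algebra X])
  then show "generated_Banach_algebra s X \<subseteq> bounded_operators s"
    by (auto simp: nest_algebra_def)
  show "V \<in> generated_Banach_algebra s X" using V generated_subset by blast
  fix a c assume a: "a \<in> generated_Banach_algebra s X"
  define b where "b = a + scale_operator s c id_blinfun"
  have b: "b \<in> nest_algebra \<P>"
    using sub gen a id_mem_nest_algebra[OF P(2)] unfolding b_def operator_subalgebra_def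
    by (intro op.subspace_add op.subspace_scale) auto
  have "V \<in> nest_algebra \<P>" using V X by blast
  then have bV: "b o\<^sub>L V \<in> nest_algebra \<P>"
    using b sub by (auto simp: operator_subalgebra_def)
  have bV_eq: "(a o\<^sub>L V) + scale_operator s c V = b o\<^sub>L V"
    by (rule blinfun_eqI) (simp add: b_def blinfun.add_left)
  define \<epsilon> where "\<epsilon> = 1 / (norm b + 1)"
  have e: "\<epsilon> > 0" "norm b * \<epsilon> < 1" by (auto simp: \<epsilon>_def field_simps add_pos_nonneg)
  obtain Q m where Q: "Q 0 = 0" "Q m = id_blinfun" "\<And>i. i \<le> m \<Longrightarrow> Q i \<in> \<P>"
    "\<And>i. i < m \<Longrightarrow> Q i o\<^sub>L Q (Suc i) = Q i" "\<And>i. i < m \<Longrightarrow> Q (Suc i) o\<^sub>L Q i = Q i"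
    "\<And>i. i < m \<Longrightarrow> norm (Q (Suc i) - Q i) \<le> 1"
    "\<And>i. i < m \<Longrightarrow> norm ((Q (Suc i) - Q i) o\<^sub>L V o\<^sub>L (Q (Suc i) - Q i)) < \<epsilon>"
    using chain[OF e(1)] by blast
  show "summable (\<lambda>n. norm (blinfun_power ((a o\<^sub>L V) + scale_operator s c V) n))"
    unfolding bV_eq
  proof (rule summable_power_of_small_diagonal_blocks[of Q m])
    show "Q 0 = 0" "Q m = id_blinfun" by fact+
    fix i
    show "Q i o\<^sub>L (b o\<^sub>L V) o\<^sub>L Q i = Q i o\<^sub>L (b o\<^sub>L V)" if "i \<le> m"
      using bV Q(3)[OF that] by (auto simp: nest_algebra_def)
    show "Q i o\<^sub>L Q i = Q i" if "i \<le> m" using P(2) Q(3) that by auto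
    assume i: "i < m"
    show "Q (Suc i) o\<^sub>L Q i = Q i" using Q(5) i by auto
    show "Q i o\<^sub>L Q (Suc i) = Q i" using Q(4) i by auto
    define E where "E = Q (Suc i) - Q i"
    have fix_b: "R (b (R x)) = R (b x)" and fix_V: "R (V (R x)) = R (V x)"
      and RR: "R (R x) = R x" if "R = Q i \<or> R = Q (Suc i)" for R x
      using b \<open>V \<in> nest_algebra \<P>\<close> Q(3)[of i] Q(3)[of "Suc i"] P(2) i that
      by (auto simp: nest_algebra_def blinfun_eq_iff)
    have QQ: "Q i (Q (Suc i) x) = Q i x" "Q (Suc i) (Q i x) = Q i x" for x
      using Q(4,5)[OF i] by (auto simp: blinfun_eq_iff)
    have V0: "Q i (V (E x)) = 0" for x
      using fix_V[of "Q i" "E x"] fix_V[of "Q i" "Q (Suc i) x"] fix_V[of "Q i" "Q i x"]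
      by (simp add: E_def blinfun_algebra QQ RR)
    have "E (b y) = E (b (E y))" if y: "Q i y = 0" for y
    proof -
      have "E (b y) = Q (Suc i) (b y) - Q i (b y)" by (simp add: E_def blinfun_algebra)
      also have "\<dots> = Q (Suc i) (b (Q (Suc i) y)) - Q i (b (Q (Suc i) y))"
        using fix_b[of "Q i" y] fix_b[of "Q i" "Q (Suc i) y"] by (simp add: fix_b QQ)
      also have "\<dots> = E (b (E y))" by (simp add: E_def blinfun_algebra y)
      finally show ?thesis .
    qed
    then have "E o\<^sub>L (b o\<^sub>L V) o\<^sub>L E = (E o\<^sub>L b) o\<^sub>L (E o\<^sub>L V o\<^sub>L E)"
      using V0 by (intro blinfun_eqI) simp
    then have "norm (E o\<^sub>L (b o\<^sub>L V) o\<^sub>L E) \<le> norm (E o\<^sub>L b) * norm (E o\<^sub>L V o\<^sub>L E)"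
      by (simp add: norm_blinfun_compose)
    also have "\<dots> \<le> (1 * norm b) * \<epsilon>"
    proof (intro mult_mono)
      show "norm (E o\<^sub>L b) \<le> 1 * norm b"
        using Q(6)[OF i] unfolding E_def[symmetric]
        by (intro order_trans[OF norm_blinfun_compose] mult_right_mono) auto
    qed (use Q(7)[OF i] in \<open>auto simp: E_def\<close>)
    also have "\<dots> < 1" using e(2) by simp
    finally show "norm ((Q (Suc i) - Q i) o\<^sub>L (b o\<^sub>L V) o\<^sub>L (Q (Suc i) - Q i)) < 1"
      by (simp add: E_def)
  qed
qed

end


section \<open>Completeness of the spaces of square integrable functions\<close>

lemma norm2_minus_commute: "norm2 M (\<lambda>x. f x - g x) = norm2 M (\<lambda>x. g x - f x)"
  by (simp add: norm2_def norm_minus_commute)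

lemma nn_integral_norm2:
  assumes "f \<in> square_integrable M"
  shows "(\<integral>\<^sup>+x. ennreal ((norm (f x))\<^sup>2) \<partial>M) = ennreal ((norm2 M f)\<^sup>2)"
  unfolding norm2_square
  by (rule nn_integral_eq_integral) (use assms in \<open>auto intro: square_integrable_integrable\<close>)

text \<open>
  If \<open>\<parallel>f\<^sub>k\<^sub>+\<^sub>1 - f\<^sub>k\<parallel> \<le> 4\<^sup>-\<^sup>k\<close>, then \<open>\<Sum>4\<^sup>k \<bar>f\<^sub>k\<^sub>+\<^sub>1 - f\<^sub>k\<bar>\<^sup>2\<close> has a finite integral and is therefore finite
  almost everywhere; at such points \<open>\<bar>f\<^sub>k\<^sub>+\<^sub>1 - f\<^sub>k\<bar> = O(2\<^sup>-\<^sup>k)\<close>.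
\<close>

lemma AE_convergent_of_rapidly_Cauchy:
  fixes f :: "nat \<Rightarrow> 'a \<Rightarrow> 'k::{real_normed_field, euclidean_space}"
  assumes f: "\<And>k. f k \<in> square_integrable M"
    and rapid: "\<And>k. norm2 M (\<lambda>x. f (Suc k) x - f k x) \<le> (1/4)^k"
  shows "AE x in M. convergent (\<lambda>k. f k x)"
proof -
  define d where "d k x = f (Suc k) x - f k x" for k x
  have d: "d k \<in> square_integrable M" for k
    unfolding d_def by (intro square_integrable_diff f)
  have [measurable]: "d k \<in> borel_measurable M" for k
    using d by (rule square_integrable_measurable)
  have dk: "(\<integral>\<^sup>+x. ennreal (4^k * (norm (d k x))\<^sup>2) \<partial>M) \<le> ennreal ((1/4)^k)" for k
  proof -
    have "(\<integral>\<^sup>+x. ennreal (4^k * (norm (d k x))\<^sup>2) \<partial>M)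
        = ennreal (4^k) * (\<integral>\<^sup>+x. ennreal ((norm (d k x))\<^sup>2) \<partial>M)"
      by (simp add: ennreal_mult nn_integral_cmult)
    also have "\<dots> = ennreal (4^k * (norm2 M (d k))\<^sup>2)"
      by (simp add: nn_integral_norm2[OF d] ennreal_mult)
    also have "\<dots> \<le> ennreal (4^k * ((1/4)^k)\<^sup>2)"
      using rapid[of k] by (intro ennreal_leI mult_left_mono power_mono) (auto simp: d_def[abs_def])
    also have "4^k * ((1/4)^k)\<^sup>2 = ((1/4)^k :: real)"
      by (simp add: power2_eq_square power_mult_distrib[symmetric])
    finally show ?thesis .
  qed
  have "(\<integral>\<^sup>+x. (\<Sum>k. ennreal (4^k * (norm (d k x))\<^sup>2)) \<partial>M)
      = (\<Sum>k. \<integral>\<^sup>+x. ennreal (4^k * (norm (d k x))\<^sup>2) \<partial>M)"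
    by (rule nn_integral_suminf) simp
  also have "\<dots> \<le> (\<Sum>k. ennreal ((1/4)^k))"
    by (intro suminf_le dk) auto
  also have "\<dots> = ennreal (\<Sum>k. (1/4)^k)"
    by (rule suminf_ennreal2) (auto intro: summable_geometric)
  also have "\<dots> < \<infinity>" by simp
  finally have "AE x in M. (\<Sum>k. ennreal (4^k * (norm (d k x))\<^sup>2)) \<noteq> \<infinity>"
    by (intro nn_integral_PInf_AE) auto
  then show ?thesis
  proof eventually_elim
    case (elim x)
    define t where "t k = 4^k * (norm (d k x))\<^sup>2" for k
    define C where "C = enn2real (\<Sum>k. ennreal (t k))"
    have bound: "norm (d k x) \<le> sqrt C * (1/2)^k" for k
    proof -
      have "ennreal (t k) = sum (\<lambda>k. ennreal (t k)) {k}" by simp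
      also have "\<dots> \<le> (\<Sum>k. ennreal (t k))"
        by (intro sum_le_suminf summableI) auto
      also have "\<dots> = ennreal C"
        using elim unfolding C_def t_def by (intro ennreal_enn2real[symmetric]) (simp add: less_top)
      finally have "t k \<le> C"
        by (simp add: C_def)
      moreover have "((2::real)^k)\<^sup>2 = 4^k"
        unfolding power2_eq_square by (simp flip: power_mult_distrib)
      ultimately have "(2^k * norm (d k x))\<^sup>2 \<le> C"
        unfolding t_def power_mult_distrib by simp
      then have "2^k * norm (d k x) \<le> sqrt C" by (rule real_le_rsqrt)
      then show ?thesis by (simp add: power_one_over divide_simps mult.commute)
    qed
    have "summable (\<lambda>k. d k x)"
      by (rule summable_comparison_test'[of "\<lambda>k. sqrt C * (1/2)^k" 0])
        (auto intro!: summable_mult summable_geometric bound)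
    moreover have "(\<Sum>k<n. d k x) = f n x - f 0 x" for n
      unfolding d_def by (rule sum_lessThan_telescope)
    ultimately have "convergent (\<lambda>n. f n x - f 0 x)"
      by (auto simp: summable_iff_convergent)
    then have "convergent (\<lambda>n. (f n x - f 0 x) + f 0 x)"
      by (intro convergent_add convergent_const)
    then show ?case by simp
  qed
qed

text \<open>
  The Riesz--Fischer theorem: a pointwise limit of a rapidly converging subsequence is also a
  limit in norm, by Fatou's lemma.
\<close>

theorem square_integrable_complete:
  fixes f :: "nat \<Rightarrow> 'a \<Rightarrow> 'k::{real_normed_field, euclidean_space}"
  assumes f: "\<And>k. f k \<in> square_integrable M"
    and cauchy: "\<And>e. e > 0 \<Longrightarrow> \<exists>N. \<forall>m\<ge>N. \<forall>n\<ge>N. norm2 M (\<lambda>x. f m x - f n x) < e"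
  shows "\<exists>g\<in>square_integrable M. (\<lambda>n. norm2 M (\<lambda>x. f n x - g x)) \<longlonglongrightarrow> 0"
proof -
  have "\<exists>N. \<forall>k. \<forall>m\<ge>N k. \<forall>n\<ge>N k. norm2 M (\<lambda>x. f m x - f n x) < (1/4)^k"
    by (intro choice allI cauchy) simp
  then obtain N where N: "\<And>k m n. m \<ge> N k \<Longrightarrow> n \<ge> N k \<Longrightarrow> norm2 M (\<lambda>x. f m x - f n x) < (1/4)^k"
    by blast
  \<comment> \<open>a partial sum instead of \<open>N k\<close> itself, so that the indices increase\<close>
  define r where "r k = (\<Sum>i\<le>k. N i)" for k
  have r: "r k \<ge> N k" "r k \<le> r (Suc k)" for k
    by (auto simp: r_def intro: member_le_sum)
  have "norm2 M (\<lambda>x. f (r (Suc k)) x - f (r k) x) \<le> (1/4)^k" for k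
    using N[of k "r (Suc k)" "r k"] r[of k] by simp
  then have conv: "AE x in M. convergent (\<lambda>k. f (r k) x)"
    by (intro AE_convergent_of_rapidly_Cauchy f)
  have [measurable]: "f k \<in> borel_measurable M" for k
    using f by (rule square_integrable_measurable)
  define g where "g x = lim (\<lambda>k. f (r k) x)" for x
  have [measurable]: "g \<in> borel_measurable M"
    unfolding g_def by (rule borel_measurable_lim_metric) simp
  have lim: "AE x in M. (\<lambda>k. f (r k) x) \<longlonglongrightarrow> g x"
    using conv by eventually_elim (simp add: g_def convergent_LIMSEQ_iff)
  have close: "(\<lambda>x. g x - f n x) \<in> square_integrable M \<and> norm2 M (\<lambda>x. g x - f n x) \<le> (1/4)^k"
    if n: "n \<ge> N k" for n k
  proof -
    have "(\<integral>\<^sup>+x. ennreal ((norm (g x - f n x))\<^sup>2) \<partial>M)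
        = (\<integral>\<^sup>+x. liminf (\<lambda>i. ennreal ((norm (f (r i) x - f n x))\<^sup>2)) \<partial>M)"
    proof (rule nn_integral_cong_AE)
      show "AE x in M. ennreal ((norm (g x - f n x))\<^sup>2)
          = liminf (\<lambda>i. ennreal ((norm (f (r i) x - f n x))\<^sup>2))"
        using lim
      proof eventually_elim
        case (elim x)
        have "(\<lambda>i. ennreal ((norm (f (r i) x - f n x))\<^sup>2)) \<longlonglongrightarrow> ennreal ((norm (g x - f n x))\<^sup>2)"
          by (intro tendsto_intros elim)
        from lim_imp_Liminf[OF _ this] show ?case by simp
      qed
    qed
    also have "\<dots> \<le> liminf (\<lambda>i. \<integral>\<^sup>+x. ennreal ((norm (f (r i) x - f n x))\<^sup>2) \<partial>M)"
      by (rule nn_integral_liminf) simp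
    also have "\<dots> \<le> ennreal (((1/4)^k)\<^sup>2)"
    proof (rule Liminf_le)
      show "\<forall>\<^sub>F i in sequentially. (\<integral>\<^sup>+x. ennreal ((norm (f (r i) x - f n x))\<^sup>2) \<partial>M) \<le> ennreal (((1/4)^k)\<^sup>2)"
      proof (rule eventually_sequentiallyI[of k])
        fix i assume "k \<le> i"
        then have "N k \<le> r i" unfolding r_def by (intro member_le_sum) auto
        then have "(norm2 M (\<lambda>x. f (r i) x - f n x))\<^sup>2 \<le> ((1/4)^k)\<^sup>2"
          using N[of k "r i" n] n by (intro power_mono) auto
        then show "(\<integral>\<^sup>+x. ennreal ((norm (f (r i) x - f n x))\<^sup>2) \<partial>M) \<le> ennreal (((1/4)^k)\<^sup>2)"
          by (subst nn_integral_norm2) (auto intro: square_integrable_diff f ennreal_leI)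
      qed
    qed simp
    finally have le: "(\<integral>\<^sup>+x. ennreal ((norm (g x - f n x))\<^sup>2) \<partial>M) \<le> ennreal (((1/4)^k)\<^sup>2)" .
    then have "(\<integral>\<^sup>+x. ennreal ((norm (g x - f n x))\<^sup>2) \<partial>M) < \<infinity>"
      by (rule le_less_trans) simp
    then have sq: "(\<lambda>x. g x - f n x) \<in> square_integrable M"
      by (auto simp: square_integrable_def integrable_iff_bounded)
    from le have "(norm2 M (\<lambda>x. g x - f n x))\<^sup>2 \<le> ((1/4)^k)\<^sup>2"
      unfolding nn_integral_norm2[OF sq] by simp
    then have "norm2 M (\<lambda>x. g x - f n x) \<le> (1/4)^k"
      by (rule power2_le_imp_le) simp
    with sq show ?thesis by blast
  qed
  show ?thesis
  proof (intro bexI)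
    show "g \<in> square_integrable M"
      using square_integrable_add[OF close[of 0 "N 0", OF order_refl, THEN conjunct1] f[of "N 0"]] by simp
    show "(\<lambda>n. norm2 M (\<lambda>x. f n x - g x)) \<longlonglongrightarrow> 0"
    proof (rule LIMSEQ_I)
      fix e :: real assume "e > 0"
      then obtain k where k: "(1/4)^k < e"
        using real_arch_pow_inv[of e "1/4"] by auto
      then show "\<exists>n0. \<forall>n\<ge>n0. norm (norm2 M (\<lambda>x. f n x - g x) - 0) < e"
        using close[of k] by (intro exI[of _ "N k"]) (auto simp: norm2_minus_commute[of _ "f _"]
            intro: le_less_trans)
    qed
  qed
qed

text \<open>Completeness makes the Neumann series of a quasinilpotent operator converge.\<close>

instance L2 :: ("{real_normed_field, euclidean_space}") banach
proof
  fix X :: "nat \<Rightarrow> 'a L2" assume "Cauchy X"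
  define f where "f n = rep_L2 (X n)" for n
  have rel: "L2_rel (f n) (f n)" and X: "X n = abs_L2 (f n)" for n
    unfolding f_def
    by (rule Quotient3_rep_reflp[OF Quotient3_L2], rule Quotient3_abs_rep[OF Quotient3_L2, symmetric])
  have sq: "f n \<in> square_integrable unit_measure" for n using rel by (simp add: L2_rel_def)
  have dist: "norm (abs_L2 g - abs_L2 h) = norm2 unit_measure (\<lambda>x. g x - h x)"
    if "g \<in> square_integrable unit_measure" "h \<in> square_integrable unit_measure"
    for g h :: "real \<Rightarrow> 'a"
    using that by (subst minus_L2.abs_eq) (auto simp: L2_rel_def norm_L2.abs_eq square_integrable_diff)
  have "\<exists>g\<in>square_integrable unit_measure. (\<lambda>n. norm2 unit_measure (\<lambda>x. f n x - g x)) \<longlonglongrightarrow> 0"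
  proof (rule square_integrable_complete[OF sq])
    fix e :: real assume "e > 0"
    then show "\<exists>N. \<forall>m\<ge>N. \<forall>n\<ge>N. norm2 unit_measure (\<lambda>x. f m x - f n x) < e"
      using \<open>Cauchy X\<close> unfolding Cauchy_def dist_norm X by (simp add: dist sq)
  qed
  then obtain g where "g \<in> square_integrable unit_measure"
    "(\<lambda>n. norm2 unit_measure (\<lambda>x. f n x - g x)) \<longlonglongrightarrow> 0" by blast
  then have "(\<lambda>n. norm (X n - abs_L2 g)) \<longlonglongrightarrow> 0" by (simp add: X dist sq)
  then show "convergent X" by (auto simp: convergent_def tendsto_norm_zero_iff LIM_zero_iff)
qed

instance l2 :: ("{real_normed_field, euclidean_space}") banach
proof
  fix X :: "nat \<Rightarrow> 'a l2" assume "Cauchy X"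
  define f where "f n = Rep_l2 (X n)" for n
  let ?c = "count_space (UNIV :: nat set)"
  have sq: "f n \<in> square_integrable ?c" for n
    using Rep_l2[of "X n"] by (simp add: f_def square_integrable_count_space)
  have dist: "norm (x - y) = norm2 ?c (\<lambda>n. Rep_l2 x n - Rep_l2 y n)" for x y :: "'a l2"
    using Rep_l2[of "x - y"]
    by (subst norm2_count_space) (auto simp: norm_l2.rep_eq minus_l2.rep_eq)
  have "\<exists>g\<in>square_integrable ?c. (\<lambda>n. norm2 ?c (\<lambda>x. f n x - g x)) \<longlonglongrightarrow> 0"
  proof (rule square_integrable_complete[OF sq])
    fix e :: real assume "e > 0"
    then show "\<exists>N. \<forall>m\<ge>N. \<forall>n\<ge>N. norm2 ?c (\<lambda>x. f m x - f n x) < e"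
      using \<open>Cauchy X\<close> unfolding Cauchy_def dist_norm by (simp add: dist f_def)
  qed
  then obtain g where g: "g \<in> square_integrable ?c"
    "(\<lambda>n. norm2 ?c (\<lambda>x. f n x - g x)) \<longlonglongrightarrow> 0" by blast
  then have "Rep_l2 (Abs_l2 g) = g"
    by (intro Abs_l2_inverse) (simp add: square_integrable_count_space)
  with g have "(\<lambda>n. norm (X n - Abs_l2 g)) \<longlonglongrightarrow> 0" by (simp add: dist f_def)
  then show "convergent X" by (auto simp: convergent_def tendsto_norm_zero_iff LIM_zero_iff)
qed


section \<open>Positive operators\<close>

lemma positive_operators_bounded: "T \<in> positive_operators s \<Longrightarrow> T \<in> bounded_operators s"
  by (simp add: positive_operators_def)

lemma positive_operators_nonneg:
  "T \<in> positive_operators s \<Longrightarrow> 0 \<le> x \<Longrightarrow> 0 \<le> blinfun_apply T x"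
  by (simp add: positive_operators_def)

lemma positive_operators_mono:
  assumes "T \<in> positive_operators s" "x \<le> y"
  shows "blinfun_apply T x \<le> blinfun_apply T y"
  using positive_operators_nonneg[OF assms(1), of "y - x"] assms(2)
  by (simp add: blinfun.diff_right)

lemma positive_power_nonneg:
  assumes "T \<in> positive_operators s" "0 \<le> x"
  shows "0 \<le> blinfun_apply (blinfun_power T n) x"
  using assms(2) by (induction n) (auto intro: positive_operators_nonneg[OF assms(1)])

lemma positive_power_mono:
  assumes "T \<in> positive_operators s" "x \<le> y"
  shows "blinfun_apply (blinfun_power T n) x \<le> blinfun_power T n y"
  using positive_power_nonneg[OF assms(1), of "y - x"] assms(2) by (simp add: blinfun.diff_right)

lemma super_right_commutant_power:
  assumes A: "A \<in> positive_operators s" and B: "B \<in> super_right_commutant s A" and x: "0 \<le> x"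
  shows "blinfun_apply (blinfun_power A n) (B x) \<le> B (blinfun_power A n x)"
proof (induction n)
  case (Suc n)
  have "A (blinfun_power A n (B x)) \<le> A (B (blinfun_power A n x))"
    by (rule positive_operators_mono[OF A Suc])
  also have "\<dots> \<le> B (A (blinfun_power A n x))"
    using B positive_operators_nonneg[of "(B o\<^sub>L A) - (A o\<^sub>L B)" s "blinfun_power A n x"]
      positive_power_nonneg[OF A x]
    by (simp add: super_right_commutant_def blinfun.diff_left)
  finally show ?case by simp
qed simp

lemma super_left_commutant_power:
  assumes A: "A \<in> positive_operators s" and B: "B \<in> super_left_commutant s A" and x: "0 \<le> x"
  shows "B (blinfun_power A n x) \<le> blinfun_apply (blinfun_power A n) (B x)"
proof (induction n)
  case (Suc n)
  have "B (A (blinfun_power A n x)) \<le> A (B (blinfun_power A n x))"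
    using B positive_operators_nonneg[of "(A o\<^sub>L B) - (B o\<^sub>L A)" s "blinfun_power A n x"]
      positive_power_nonneg[OF A x]
    by (simp add: super_left_commutant_def blinfun.diff_left)
  also have "\<dots> \<le> A (blinfun_power A n (B x))"
    by (rule positive_operators_mono[OF A Suc])
  finally show ?case by simp
qed simp


lemma nonneg_Reals_norm_mono:
  fixes x y :: "'k::{real_normed_field, euclidean_space}"
  assumes "x \<in> \<real>\<^sub>\<ge>\<^sub>0" "y - x \<in> \<real>\<^sub>\<ge>\<^sub>0"
  shows "norm x \<le> norm y"
proof -
  obtain r t where r: "x = of_real r" "r \<ge> 0" and t: "y - x = of_real t" "t \<ge> 0"
    using assms by (auto simp: nonneg_Reals_def)
  then have "y = of_real (r + t)" by (simp add: algebra_simps)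
  with r t show ?thesis by (simp del: of_real_add)
qed


section \<open>The Donoghue operator\<close>

lemma l2_eqI: "(\<And>n. Rep_l2 x n = Rep_l2 y n) \<Longrightarrow> x = y"
  by (simp add: Rep_l2_inject[symmetric] fun_eq_iff)

lemma summable_l2: "summable (\<lambda>n. (norm (Rep_l2 x n))\<^sup>2)"
  using Rep_l2[of x] by simp

lemma norm_l2_mono:
  assumes "\<And>n. norm (Rep_l2 y n) \<le> norm (Rep_l2 x n)"
  shows "norm y \<le> norm x"
  unfolding norm_l2.rep_eq
  by (intro real_sqrt_le_mono suminf_le power_mono assms summable_l2 norm_ge_zero)

lemma norm_coordinate_le: "norm (Rep_l2 x n) \<le> norm x"
proof -
  have "(norm (Rep_l2 x n))\<^sup>2 \<le> (\<Sum>n. (norm (Rep_l2 x n))\<^sup>2)"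
    using sum_le_suminf[OF summable_l2[of x], of "{n}"] by simp
  then show ?thesis unfolding norm_l2.rep_eq by (rule real_le_rsqrt)
qed

lemma norm_basis_l2: "norm (basis_l2 n :: 'k::{real_normed_field, euclidean_space} l2) = 1"
proof -
  have "(\<Sum>k. (norm (Rep_l2 (basis_l2 n :: 'k l2) k))\<^sup>2) = (\<Sum>k\<in>{n}. (norm (Rep_l2 (basis_l2 n :: 'k l2) k))\<^sup>2)"
    by (rule suminf_finite) (auto simp: basis_l2.rep_eq)
  then show ?thesis by (simp add: norm_l2.rep_eq basis_l2.rep_eq)
qed

lemma basis_l2_nonneg: "0 \<le> basis_l2 n"
  by (simp add: less_eq_l2.rep_eq zero_l2.rep_eq basis_l2.rep_eq)

interpretation l2: operator_space "scale_l2 :: 'k::{real_normed_field, euclidean_space} \<Rightarrow> _"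
  by (rule operator_space.intro[OF vector_space_l2 scale_l2_of_real norm_scale_l2])

lift_definition tail_map :: "nat \<Rightarrow> 'k l2 \<Rightarrow> 'k::{real_normed_field, euclidean_space} l2"
  is "\<lambda>N x n. if n < N then 0 else x n"
  by (rule summable_comparison_test'[where N = 0]) auto

lift_definition tail :: "nat \<Rightarrow> 'k l2 \<Rightarrow>\<^sub>L 'k::{real_normed_field, euclidean_space} l2"
  is tail_map
proof (rule bounded_linear_intro[where K = 1])
  fix N and x y :: "'k l2" and r
  show "tail_map N (x + y) = tail_map N x + tail_map N y"
    by (rule l2_eqI) (simp add: plus_l2.rep_eq tail_map.rep_eq)
  show "tail_map N (r *\<^sub>R x) = r *\<^sub>R tail_map N x"
    by (rule l2_eqI) (simp add: scaleR_l2.rep_eq tail_map.rep_eq)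
  show "norm (tail_map N x) \<le> norm x * 1"
    by (simp, rule norm_l2_mono) (simp add: tail_map.rep_eq)
qed

lemma tail_apply: "Rep_l2 (tail N x) n = (if n < N then 0 else Rep_l2 x n)"
  by (simp add: tail.rep_eq tail_map.rep_eq)

lemma l2_head_eq_sum:
  "x - tail N x = (\<Sum>n<N. scale_l2 (Rep_l2 x n) (basis_l2 n))"
proof (induction N)
  case 0
  show ?case by (rule l2_eqI) (simp add: minus_l2.rep_eq zero_l2.rep_eq tail_apply)
next
  case (Suc N)
  have "tail N x = tail (Suc N) x + scale_l2 (Rep_l2 x N) (basis_l2 N)"
    by (rule l2_eqI) (auto simp: plus_l2.rep_eq tail_apply scale_l2.rep_eq basis_l2.rep_eq less_Suc_eq)
  then show ?case using Suc by (simp add: algebra_simps)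
qed

context
  fixes w :: "nat \<Rightarrow> real"
  assumes w_pos: "\<And>n. n \<ge> 1 \<Longrightarrow> w n > 0"
    and w_decreasing: "\<And>m n. 1 \<le> m \<Longrightarrow> m \<le> n \<Longrightarrow> w n \<le> w m"
    and w_l2: "summable (\<lambda>n. (w (Suc n))\<^sup>2)"
begin

lemma donoghue_coordinate:
  "Rep_l2 (donoghue w x) n = of_real (w (Suc n)) * Rep_l2 x (Suc n)"
  using w_pos w_decreasing[of 1] by (intro donoghue_apply[where C = "w 1"]) (simp add: abs_of_pos)

lemma weights_tendsto_0: "(\<lambda>n. w (Suc n)) \<longlonglongrightarrow> 0"
  using tendsto_real_sqrt[OF summable_LIMSEQ_zero[OF w_l2]]
  by (simp add: tendsto_rabs_zero_iff)

lemma donoghue_power_coordinate: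
  "Rep_l2 (blinfun_power (donoghue w) m x) n = of_real (\<Prod>i<m. w (Suc (n + i))) * Rep_l2 x (n + m)"
proof (induction m arbitrary: n)
  case (Suc m)
  have "(\<Prod>i<Suc m. w (Suc (n + i))) = w (Suc n) * (\<Prod>i<m. w (Suc (Suc n + i)))"
    by (subst prod.lessThan_Suc_shift) simp
  then show ?case by (simp add: donoghue_coordinate Suc del: prod.lessThan_Suc)
qed simp

lemma donoghue_positive:
  "donoghue w \<in> positive_operators (scale_l2 :: 'k::{real_normed_field, euclidean_space} \<Rightarrow> _)"
  unfolding positive_operators_def
proof (intro CollectI conjI allI impI)
  show "(donoghue w :: 'k l2 \<Rightarrow>\<^sub>L 'k l2) \<in> bounded_operators scale_l2"
    unfolding l2.bounded_operators_iff
    by (intro allI l2_eqI) (simp add: donoghue_coordinate scale_l2.rep_eq)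
  show "0 \<le> donoghue w x" if "0 \<le> x" for x :: "'k l2"
    using that w_pos
    by (auto simp: less_eq_l2.rep_eq zero_l2.rep_eq donoghue_coordinate
        intro!: nonneg_Reals_mult_I less_imp_le)
qed

text \<open>
  If \<open>S B \<le> B S\<close>, then \<open>0 \<le> S\<^sup>n\<^sup>+\<^sup>1 B e\<^sub>n \<le> B S\<^sup>n\<^sup>+\<^sup>1 e\<^sub>n = 0\<close>, and the kernel of \<open>S\<^sup>n\<^sup>+\<^sup>1\<close>
  is spanned by \<open>e\<^sub>0, \<dots>, e\<^sub>n\<close> because the weights do not vanish.
\<close>

lemma super_right_commutant_upper_triangular:
  fixes B :: "'k::{real_normed_field, euclidean_space} l2 \<Rightarrow>\<^sub>L 'k l2"
  assumes B: "B \<in> super_right_commutant scale_l2 (donoghue w)" and k: "n < k"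
  shows "Rep_l2 (B (basis_l2 n)) k = 0"
proof -
  let ?S = "donoghue w :: 'k l2 \<Rightarrow>\<^sub>L 'k l2"
  have Bpos: "B \<in> positive_operators scale_l2" using B by (simp add: super_right_commutant_def)
  have "blinfun_power ?S (Suc n) (B (basis_l2 n)) \<le> B (blinfun_power ?S (Suc n) (basis_l2 n))"
    by (rule super_right_commutant_power[OF donoghue_positive B basis_l2_nonneg])
  also have "blinfun_power ?S (Suc n) (basis_l2 n) = 0"
    by (rule l2_eqI)
      (simp add: donoghue_power_coordinate basis_l2.rep_eq zero_l2.rep_eq
        del: blinfun_power_Suc_apply prod.lessThan_Suc)
  finally have "blinfun_power ?S (Suc n) (B (basis_l2 n)) \<le> 0" by simp
  then have "blinfun_power ?S (Suc n) (B (basis_l2 n)) = 0"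
    by (intro antisym positive_power_nonneg[OF donoghue_positive]
        positive_operators_nonneg[OF Bpos] basis_l2_nonneg)
  then have "Rep_l2 (blinfun_power ?S (Suc n) (B (basis_l2 n))) (k - Suc n) = 0"
    by (simp add: zero_l2.rep_eq)
  then have "(\<Prod>i<Suc n. w (Suc (k - Suc n + i))) = 0 \<or> Rep_l2 (B (basis_l2 n)) k = 0"
    using k unfolding donoghue_power_coordinate by (simp del: prod.lessThan_Suc)
  moreover have "(\<Prod>i<Suc n. w (Suc (k - Suc n + i))) > 0"
    by (intro prod_pos ballI w_pos) simp
  ultimately show ?thesis by linarith
qed

text \<open>
  If \<open>B S \<le> S B\<close>, then writing \<open>e\<^sub>n\<close> as a multiple of \<open>S\<^sup>m e\<^sub>n\<^sub>+\<^sub>m\<close> bounds the coordinate of \<open>B e\<^sub>n\<close> at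
  \<open>n + d\<close> by \<open>\<parallel>B\<parallel> (w\<^sub>n\<^sub>+\<^sub>m\<^sub>+\<^sub>1 \<cdots> w\<^sub>n\<^sub>+\<^sub>m\<^sub>+\<^sub>d) / (w\<^sub>n\<^sub>+\<^sub>1 \<cdots> w\<^sub>n\<^sub>+\<^sub>d)\<close>, which tends to \<open>0\<close> as
  \<open>m \<rightarrow> \<infinity>\<close>.
\<close>

lemma super_left_commutant_upper_triangular:
  fixes B :: "'k::{real_normed_field, euclidean_space} l2 \<Rightarrow>\<^sub>L 'k l2"
  assumes B: "B \<in> super_left_commutant scale_l2 (donoghue w)" and k: "n < k"
  shows "Rep_l2 (B (basis_l2 n)) k = 0"
proof -
  let ?S = "donoghue w :: 'k l2 \<Rightarrow>\<^sub>L 'k l2"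
  define p where "p j m = (\<Prod>i<m. w (Suc (j + i)))" for j m
  have p_pos: "p j m > 0" for j m
    unfolding p_def by (intro prod_pos ballI w_pos) simp
  have p_add: "p j (m + l) = p j m * p (j + m) l" for j m l
    unfolding p_def by (induction l) (auto simp: add.assoc)
  obtain d where d: "k = n + d" "d > 0" using k less_imp_add_positive by blast
  have Bpos: "B \<in> positive_operators scale_l2" using B by (simp add: super_left_commutant_def)
  define c where "c = norm (Rep_l2 (B (basis_l2 n)) k)"
  \<comment> \<open>\<open>p k m / p n m = p (n + m) d / p n d\<close>, since the weights common to both products cancel\<close>
  have "c * p n d \<le> p (n + m) d * norm B" for m
  proof -
    have "blinfun_power ?S m (basis_l2 (n + m)) = scale_l2 (of_real (p n m)) (basis_l2 n)"
      by (rule l2_eqI) (auto simp: donoghue_power_coordinate basis_l2.rep_eq scale_l2.rep_eq p_def)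
    then have eq: "B (blinfun_power ?S m (basis_l2 (n + m))) = scale_l2 (of_real (p n m)) (B (basis_l2 n))"
      using l2.bounded_operators_scale[OF positive_operators_bounded[OF Bpos]] by simp
    have le: "B (blinfun_power ?S m (basis_l2 (n + m))) \<le> blinfun_power ?S m (B (basis_l2 (n + m)))"
      by (rule super_left_commutant_power[OF donoghue_positive B basis_l2_nonneg])
    have nn: "0 \<le> B (blinfun_power ?S m (basis_l2 (n + m)))"
      by (intro positive_operators_nonneg[OF Bpos] positive_power_nonneg[OF donoghue_positive] basis_l2_nonneg)
    have "norm (Rep_l2 (B (blinfun_power ?S m (basis_l2 (n + m)))) k)
        \<le> norm (Rep_l2 (blinfun_power ?S m (B (basis_l2 (n + m)))) k)"
      using le nn by (intro nonneg_Reals_norm_mono) (auto simp: less_eq_l2.rep_eq zero_l2.rep_eq)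
    also have "\<dots> = p k m * norm (Rep_l2 (B (basis_l2 (n + m))) (k + m))"
      unfolding donoghue_power_coordinate p_def[symmetric] using p_pos[of k m] by (simp add: norm_mult)
    also have "\<dots> \<le> p k m * norm B"
      using norm_coordinate_le[of "B (basis_l2 (n + m))" "k + m"] norm_blinfun[of B "basis_l2 (n + m)"]
        p_pos[of k m]
      by (intro mult_left_mono) (auto simp: norm_basis_l2)
    finally have "p n m * c \<le> p k m * norm B"
      unfolding eq using p_pos[of n m] by (simp add: scale_l2.rep_eq norm_mult c_def)
    then have "p n m * c * p n d \<le> p k m * norm B * p n d"
      using p_pos[of n d] by (intro mult_right_mono) auto
    also have "\<dots> = p n m * (p (n + m) d * norm B)"
      using p_add[of n d m] p_add[of n m d] d by (simp add: add.commute mult.commute mult.left_commute)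
    finally have "p n m * (c * p n d) \<le> p n m * (p (n + m) d * norm B)" by (simp add: mult.assoc)
    then show ?thesis using p_pos[of n m] by simp
  qed
  moreover have "(\<lambda>m. p (n + m) d * norm B) \<longlonglongrightarrow> 0"
  proof -
    have "(\<lambda>m. w (Suc (n + m + i))) \<longlonglongrightarrow> 0" for i
      using LIMSEQ_ignore_initial_segment[OF weights_tendsto_0, of "n + i"]
      by (simp add: ac_simps)
    then have "(\<lambda>m. p (n + m) d) \<longlonglongrightarrow> (\<Prod>i<d. 0)"
      unfolding p_def by (intro tendsto_prod)
    moreover have "(\<Prod>i<d. 0 :: real) = 0" using d(2) by simp
    ultimately show ?thesis by (intro tendsto_mult_left_zero) (simp only:)
  qed
  ultimately have "c * p n d \<le> 0" by (intro LIMSEQ_le_const) auto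
  then have "c \<le> 0" using p_pos[of n d] by (simp add: mult_le_0_iff)
  then show ?thesis by (simp add: c_def)
qed

text \<open>
  The kernel of \<open>tail N\<close> is the span of \<open>e\<^sub>0, \<dots>, e\<^sub>N\<^sub>-\<^sub>1\<close>.  The zero projection, which is no \<open>tail\<close>, is
  added as the bottom element of the nest.
\<close>

lemma donoghue_super_commutants_subset_nest_algebra:
  "super_left_commutant scale_l2 (donoghue w) \<union> super_right_commutant scale_l2 (donoghue w)
    \<subseteq> l2.nest_algebra (insert 0 (range (tail :: nat \<Rightarrow> 'k::{real_normed_field, euclidean_space} l2 \<Rightarrow>\<^sub>L _)))"
proof
  fix B :: "'k l2 \<Rightarrow>\<^sub>L 'k l2"
  assume B: "B \<in> super_left_commutant scale_l2 (donoghue w) \<union> super_right_commutant scale_l2 (donoghue w)"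
  then have bo: "B \<in> bounded_operators scale_l2"
    by (auto simp: super_left_commutant_def super_right_commutant_def positive_operators_def)
  have "tail N o\<^sub>L B o\<^sub>L tail N = tail N o\<^sub>L B" for N
  proof (rule blinfun_eqI)
    fix x :: "'k l2"
    have "tail N (B (scale_l2 (Rep_l2 x n) (basis_l2 n))) = 0" if "n < N" for n
    proof (rule l2_eqI)
      fix k
      have "Rep_l2 (B (basis_l2 n)) k = 0" if "N \<le> k"
        using B super_left_commutant_upper_triangular[of B n k]
          super_right_commutant_upper_triangular[of B n k] \<open>n < N\<close> that by auto
      then show "Rep_l2 (tail N (B (scale_l2 (Rep_l2 x n) (basis_l2 n)))) k = Rep_l2 0 k"
        by (simp add: l2.bounded_operators_scale[OF bo] tail_apply scale_l2.rep_eq zero_l2.rep_eq)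
    qed
    then have "tail N (B (x - tail N x)) = 0"
      by (simp add: l2_head_eq_sum blinfun.sum_right)
    then show "(tail N o\<^sub>L B o\<^sub>L tail N) x = (tail N o\<^sub>L B) x"
      by (simp add: blinfun.diff_right)
  qed
  with bo show "B \<in> l2.nest_algebra (insert 0 (range tail))"
    by (auto simp: l2.nest_algebra_def)
qed

text \<open>
  The diagonal blocks of \<open>S\<close> with respect to the nest are the entries \<open>0\<close>, apart from the compression
  to the coordinates from \<open>N\<close> on, which has norm at most \<open>w\<^sub>N\<^sub>+\<^sub>1\<close>.
\<close>

lemma donoghue_mem_radical:
  "donoghue w \<in> radical scale_l2 (generated_Banach_algebra (scale_l2 :: 'k::{real_normed_field, euclidean_space} \<Rightarrow> _)
    (super_left_commutant scale_l2 (donoghue w) \<union> super_right_commutant scale_l2 (donoghue w)))"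
proof (rule l2.radical_of_small_diagonal[OF _ _ donoghue_super_commutants_subset_nest_algebra])
  show "insert 0 (range tail) \<subseteq> bounded_operators (scale_l2 :: 'k \<Rightarrow> _)"
    by (auto simp: l2.bounded_operators_iff tail_apply scale_l2.rep_eq intro!: l2_eqI)
  show "P o\<^sub>L P = P" if "P \<in> insert 0 (range tail)" for P :: "'k l2 \<Rightarrow>\<^sub>L 'k l2"
    using that by (auto intro!: blinfun_eqI l2_eqI simp: tail_apply)
  have "(0 :: 'k l2 \<Rightarrow>\<^sub>L 'k l2) \<in> positive_operators scale_l2"
    by (simp add: positive_operators_def l2.bounded_operators_iff)
  then show "donoghue w \<in> super_left_commutant scale_l2 (donoghue w) \<union> super_right_commutant (scale_l2 :: 'k \<Rightarrow> _) (donoghue w)"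
    by (intro UnI2) (simp add: super_right_commutant_def donoghue_positive)
  let ?S = "donoghue w :: 'k l2 \<Rightarrow>\<^sub>L 'k l2"
  fix \<epsilon> :: real assume \<epsilon>: "\<epsilon> > 0"
  then obtain N where N: "w (Suc N) < \<epsilon>"
    using order_tendstoD(2)[OF weights_tendsto_0 \<epsilon>] by (auto simp: eventually_sequentially)
  define P :: "nat \<Rightarrow> 'k l2 \<Rightarrow>\<^sub>L 'k l2" where "P i = (if i = 0 then 0 else tail (Suc N - i))" for i
  show "\<exists>P m. P 0 = 0 \<and> P m = id_blinfun \<and> (\<forall>i\<le>m. P i \<in> insert 0 (range tail)) \<and>
      (\<forall>i<m. P i o\<^sub>L P (Suc i) = P i \<and> P (Suc i) o\<^sub>L P i = P i \<and> norm (P (Suc i) - P i) \<le> 1 \<and>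
        norm ((P (Suc i) - P i) o\<^sub>L ?S o\<^sub>L (P (Suc i) - P i)) < \<epsilon>)"
  proof (intro exI[of _ P] exI[of _ "Suc N"] conjI allI impI)
    show "P 0 = 0" by (simp add: P_def)
    show "P (Suc N) = id_blinfun" by (intro blinfun_eqI l2_eqI) (simp add: P_def tail_apply)
    show "P i \<in> insert 0 (range tail)" for i by (simp add: P_def)
    fix i assume i: "i < Suc N"
    show "P i o\<^sub>L P (Suc i) = P i" "P (Suc i) o\<^sub>L P i = P i"
      using i by (auto intro!: blinfun_eqI l2_eqI simp: P_def tail_apply zero_l2.rep_eq)
    show "norm (P (Suc i) - P i) \<le> 1"
      by (rule norm_blinfun_bound)
        (auto intro!: norm_l2_mono simp: P_def tail_apply zero_l2.rep_eq minus_l2.rep_eq blinfun.diff_left)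
    show "norm ((P (Suc i) - P i) o\<^sub>L ?S o\<^sub>L (P (Suc i) - P i)) < \<epsilon>"
    proof (cases "i = 0")
      case False
      have "(P (Suc i) - P i) o\<^sub>L ?S o\<^sub>L (P (Suc i) - P i) = 0"
        using i False by (intro blinfun_eqI l2_eqI)
          (auto simp: P_def tail_apply zero_l2.rep_eq minus_l2.rep_eq blinfun.diff_left donoghue_coordinate)
      then show ?thesis using \<epsilon> by simp
    next
      case True
      \<comment> \<open>the compression is the Donoghue operator whose first \<open>N\<close> weights are replaced by \<open>0\<close>\<close>
      define v where "v n = (if n \<le> N then 0 else w n)" for n
      have v: "\<bar>v (Suc n)\<bar> \<le> w (Suc N)" for n
        using w_pos[of "Suc n"] w_pos[of "Suc N"] w_decreasing[of "Suc N" "Suc n"]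
        by (auto simp: v_def)
      have "norm (tail N o\<^sub>L ?S o\<^sub>L tail N) \<le> w (Suc N)"
      proof (rule norm_blinfun_bound)
        show "w (Suc N) \<ge> 0" using w_pos[of "Suc N"] by simp
        fix x :: "'k l2"
        have "Rep_l2 ((tail N o\<^sub>L ?S o\<^sub>L tail N) x) n = of_real (v (Suc n)) * Rep_l2 x (Suc n)" for n
          by (simp add: tail_apply donoghue_coordinate v_def)
        then have "norm ((tail N o\<^sub>L ?S o\<^sub>L tail N) x) \<le> sqrt ((w (Suc N))\<^sup>2 * (\<Sum>n. (norm (Rep_l2 x n))\<^sup>2))"
          unfolding norm_l2.rep_eq
          using donoghue_bounded(2)[where w = v and C = "w (Suc N)", OF v summable_l2[of x]] by (intro real_sqrt_le_mono) simp
        then show "norm ((tail N o\<^sub>L ?S o\<^sub>L tail N) x) \<le> w (Suc N) * norm x"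
          using w_pos[of "Suc N"] by (simp add: norm_l2.rep_eq real_sqrt_mult)
      qed
      with N True show ?thesis by (simp add: P_def)
    qed
  qed
qed

end


section \<open>The nest of the Volterra operator\<close>

lemma measurable_unit_id [measurable]: "(\<lambda>x. x) \<in> borel_measurable unit_measure"
  by (rule measurable_restrict_space1, rule measurable_completion) simp

lemma AE_unit_iff: "(AE x in unit_measure. P x) \<longleftrightarrow> (AE x in lebesgue. x \<in> {0..1} \<longrightarrow> P x)"
  by (rule AE_restrict_space_iff) simp

lemma norm2_mono_AE:
  assumes "f \<in> square_integrable M" "g \<in> square_integrable M"
    and "AE x in M. norm (f x) \<le> norm (g x)"
  shows "norm2 M f \<le> norm2 M g"
  unfolding norm2_def
proof (intro real_sqrt_le_mono integral_mono_AE square_integrable_integrable assms)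
  show "AE x in M. (norm (f x))\<^sup>2 \<le> (norm (g x))\<^sup>2"
    using assms(3) by eventually_elim (simp add: power_mono)
qed

lemma square_integrable_dominated:
  assumes "g \<in> square_integrable M" "f \<in> borel_measurable M"
    and "AE x in M. norm (f x) \<le> norm (g x)"
  shows "f \<in> square_integrable M"
proof -
  have "integrable M (\<lambda>x. (norm (f x))\<^sup>2)"
  proof (rule Bochner_Integration.integrable_bound[OF square_integrable_integrable[OF assms(1)]])
    show "(\<lambda>x. (norm (f x))\<^sup>2) \<in> borel_measurable M" using assms(2) by measurable
    show "AE x in M. norm ((norm (f x))\<^sup>2) \<le> norm ((norm (g x))\<^sup>2)"
      using assms(3) by eventually_elim (simp add: power_mono)
  qed
  with assms(2) show ?thesis by (simp add: square_integrable_def)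
qed

lemma square_integrable_unit_const: "(\<lambda>x. C) \<in> square_integrable unit_measure"
  by (simp add: square_integrable_def integrable_restrict_space)

lemma norm2_unit_le_const:
  assumes "f \<in> square_integrable unit_measure" "AE x in unit_measure. norm (f x) \<le> C" "0 \<le> C"
  shows "norm2 unit_measure f \<le> C"
proof -
  have "norm2 unit_measure f \<le> norm2 unit_measure (\<lambda>x. C)"
    using assms by (intro norm2_mono_AE square_integrable_unit_const) auto
  also have "\<dots> = C" using assms(3) by (simp add: norm2_def measure_restrict_space)
  finally show ?thesis .
qed

lemma norm_L2_mono:
  fixes f g :: "'k::{real_normed_field, euclidean_space} L2"
  assumes "0 \<le> f" "f \<le> g"
  shows "norm f \<le> norm g"
  using assms
proof transfer
  fix f g :: "real \<Rightarrow> 'k"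
  assume "L2_rel f f" "L2_rel g g" "AE x in unit_measure. f x - 0 \<in> \<real>\<^sub>\<ge>\<^sub>0"
    "AE x in unit_measure. g x - f x \<in> \<real>\<^sub>\<ge>\<^sub>0"
  then show "norm2 unit_measure f \<le> norm2 unit_measure g"
    by (intro norm2_mono_AE) (auto simp: L2_rel_def elim: eventually_elim2 intro: nonneg_Reals_norm_mono)
qed

interpretation L2: operator_space "scale_L2 :: 'k::{real_normed_field, euclidean_space} \<Rightarrow> _"
  by (rule operator_space.intro[OF vector_space_L2 scale_L2_of_real norm_scale_L2])

lemma cutoff_square_integrable:
  assumes "f \<in> square_integrable unit_measure"
  shows "(\<lambda>x. if x \<le> a then f x else 0) \<in> square_integrable unit_measure"
    and "norm2 unit_measure (\<lambda>x. if x \<le> a then f x else 0) \<le> norm2 unit_measure f"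
proof -
  have [measurable]: "f \<in> borel_measurable unit_measure" using assms by measurable
  show *: "(\<lambda>x. if x \<le> a then f x else 0) \<in> square_integrable unit_measure"
    by (rule square_integrable_dominated[OF assms]) auto
  show "norm2 unit_measure (\<lambda>x. if x \<le> a then f x else 0) \<le> norm2 unit_measure f"
    by (rule norm2_mono_AE[OF * assms]) auto
qed

lift_definition cutoff_map :: "real \<Rightarrow> 'k L2 \<Rightarrow> 'k::{real_normed_field, euclidean_space} L2"
  is "\<lambda>a f x. if x \<le> a then f x else 0"
  by (auto simp: L2_rel_def cutoff_square_integrable elim: eventually_mono)

lift_definition cutoff :: "real \<Rightarrow> 'k L2 \<Rightarrow>\<^sub>L 'k::{real_normed_field, euclidean_space} L2"
  is cutoff_map
proof (rule bounded_linear_intro[where K = 1])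
  fix a and f g :: "'k L2" and r
  show "cutoff_map a (f + g) = cutoff_map a f + cutoff_map a g"
    by transfer (auto simp: L2_rel_def intro!: square_integrable_add cutoff_square_integrable)
  show "cutoff_map a (r *\<^sub>R f) = r *\<^sub>R cutoff_map a f"
    by transfer (auto simp: L2_rel_def intro!: square_integrable_scaleR cutoff_square_integrable)
  show "norm (cutoff_map a f) \<le> norm f * 1"
    by transfer (simp add: L2_rel_def cutoff_square_integrable)
qed

lemma cutoff_mem_bounded_operators: "cutoff a \<in> bounded_operators scale_L2"
  unfolding L2.bounded_operators_iff cutoff.rep_eq
  by transfer (auto simp: L2_rel_def intro!: square_integrable_scale cutoff_square_integrable)

lemma cutoff_cutoff: "cutoff a o\<^sub>L cutoff b = cutoff (min a b)"
proof (rule blinfun_eqI)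
  fix f :: "'a L2"
  show "(cutoff a o\<^sub>L cutoff b) f = cutoff (min a b) f"
    unfolding blinfun_apply_blinfun_compose cutoff.rep_eq
  proof transfer
    fix a b :: real and f :: "real \<Rightarrow> 'a" assume "L2_rel f f"
    then have "L2_rel (\<lambda>x. if x \<le> min a b then f x else 0) (\<lambda>x. if x \<le> min a b then f x else 0)"
      unfolding L2_rel_def by (intro conjI cutoff_square_integrable) auto
    moreover have "(\<lambda>x. if x \<le> a then if x \<le> b then f x else 0 else 0) = (\<lambda>x. if x \<le> min a b then f x else 0)"
      by auto
    ultimately show "L2_rel (\<lambda>x. if x \<le> a then if x \<le> b then f x else 0 else 0) (\<lambda>x. if x \<le> min a b then f x else 0)"
      by (simp only:)
  qed
qed

lemma cutoff_1: "cutoff 1 = id_blinfun"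
proof (rule blinfun_eqI)
  fix f :: "'a L2"
  show "cutoff 1 f = id_blinfun f"
    by (simp add: cutoff.rep_eq, transfer) (auto simp: L2_rel_def intro!: cutoff_square_integrable AE_I2)
qed

lemma cutoff_positive: "cutoff a \<in> positive_operators scale_L2"
  unfolding positive_operators_def cutoff.rep_eq
  using cutoff_mem_bounded_operators
  by (auto simp: cutoff.rep_eq) (transfer, auto elim: eventually_mono)

text \<open>
  For each \<open>c\<close> there is an exceptional null set; rational \<open>c\<close> suffice, so countably many of them occur.
\<close>

lemma cutoff_eq_0_of_smaller:
  fixes f :: "'k::{real_normed_field, euclidean_space} L2"
  assumes "\<And>c. 0 \<le> c \<Longrightarrow> c < a \<Longrightarrow> cutoff c f = 0"
  shows "cutoff a f = 0"
proof -
  have "\<forall>c. 0 \<le> c \<longrightarrow> c < a \<longrightarrow> cutoff_map c f = 0" using assms by (simp add: cutoff.rep_eq)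
  then have "cutoff_map a f = 0"
  proof transfer
    fix a and f :: "real \<Rightarrow> 'k"
    assume f: "L2_rel f f"
      and "\<forall>c. 0 \<le> c \<longrightarrow> c < a \<longrightarrow> L2_rel (\<lambda>x. if x \<le> c then f x else 0) (\<lambda>x. 0)"
    then have "\<forall>c\<in>\<rat> \<inter> {0..<a}. AE x in unit_measure. x \<le> c \<longrightarrow> f x = 0"
      by (auto simp: L2_rel_def elim: eventually_mono)
    then have "AE x in unit_measure. \<forall>c\<in>\<rat> \<inter> {0..<a}. x \<le> c \<longrightarrow> f x = 0"
      by (subst AE_ball_countable) (auto intro: countable_Int1 countable_rat)
    moreover have "AE x in unit_measure. x \<noteq> a"
      unfolding AE_unit_iff by (rule AE_mp[OF AE_completion[OF AE_lborel_singleton]]) auto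
    ultimately have "AE x in unit_measure. (if x \<le> a then f x else 0) = 0"
      using AE_space
    proof eventually_elim
      case (elim x)
      show ?case
      proof (cases "x < a")
        case True
        then obtain c where "c \<in> \<rat>" "x < c" "c < a" using Rats_dense_in_real by blast
        then show ?thesis using bspec[OF elim(1), of c] elim(3) by auto
      qed (use elim in auto)
    qed
    with f show "L2_rel (\<lambda>x. if x \<le> a then f x else 0) (\<lambda>x. 0)"
      by (simp add: L2_rel_def cutoff_square_integrable square_integrable_zero)
  qed
  then show ?thesis by (simp add: cutoff.rep_eq)
qed


section \<open>Iterated integrals of indicator functions\<close>

lemma ramp_square_integrable:
  "(\<lambda>x. if c \<le> x then of_real ((x - c) ^ n / fact n) else 0 :: 'k::{real_normed_field, euclidean_space})
    \<in> square_integrable unit_measure"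
proof (rule square_integrable_dominated[OF square_integrable_unit_const[of "(1 + \<bar>c\<bar>) ^ n"]])
  show "(\<lambda>x. if c \<le> x then of_real ((x - c) ^ n / fact n) else 0 :: 'k) \<in> borel_measurable unit_measure"
    by measurable
  have "(x - c) ^ n / fact n \<le> (1 + \<bar>c\<bar>) ^ n" if "0 \<le> x" "x \<le> 1" "c \<le> x" for x :: real
  proof -
    have "(x - c) ^ n / fact n \<le> (x - c) ^ n / 1"
      using that by (intro divide_left_mono fact_ge_1) auto
    also have "\<dots> \<le> (1 + \<bar>c\<bar>) ^ n" using that by (simp, intro power_mono) auto
    finally show ?thesis .
  qed
  then show "AE x in unit_measure. norm (if c \<le> x then of_real ((x - c) ^ n / fact n) else 0 :: 'k)
      \<le> norm ((1 + \<bar>c\<bar>) ^ n)"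
    by (intro AE_I2) (auto simp: abs_divide power_abs simp del: of_real_divide of_real_power of_real_diff)
qed

text \<open>For \<open>0 \<le> c\<close>, the \<open>n\<close>-fold iterated integral of the indicator function of \<open>[c,1]\<close>.\<close>

lift_definition ramp :: "real \<Rightarrow> nat \<Rightarrow> 'k::{real_normed_field, euclidean_space} L2"
  is "\<lambda>c n x. if c \<le> x then of_real ((x - c) ^ n / fact n) else 0"
  by (simp only: L2_rel_def ramp_square_integrable) simp

lemma ramp_nonneg: "0 \<le> ramp c n"
  by transfer (auto simp del: of_real_divide of_real_power of_real_diff)

lemma ramp_has_integral:
  assumes "0 \<le> c"
  shows "((\<lambda>t. if c \<le> t then of_real ((t - c) ^ n / fact n) else 0 :: 'k::{real_normed_field, euclidean_space})
    has_integral (if c \<le> x then of_real ((x - c) ^ Suc n / fact (Suc n)) else 0)) {0..x}"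
proof (cases "c \<le> x")
  case False
  then show ?thesis by (auto intro!: has_integral_is_0)
next
  case True
  have "((\<lambda>t. (t - c) ^ n / fact n) has_integral
      (x - c) ^ Suc n / fact (Suc n) - (c - c) ^ Suc n / fact (Suc n)) {c..x}"
  proof (rule fundamental_theorem_of_calculus[OF True])
    fix t
    have "((\<lambda>t. (t - c) ^ Suc n / fact (Suc n)) has_real_derivative (t - c) ^ n / fact n) (at t within {c..x})"
      by (auto intro!: derivative_eq_intros simp del: power_Suc fact_Suc simp: field_simps)
        (simp add: field_simps)
    then show "((\<lambda>t. (t - c) ^ Suc n / fact (Suc n)) has_vector_derivative (t - c) ^ n / fact n) (at t within {c..x})"
      by (simp only: has_real_derivative_iff_has_vector_derivative)
  qed
  then have "((\<lambda>t. (t - c) ^ n / fact n) has_integral (x - c) ^ Suc n / fact (Suc n)) {c..x}"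
    by simp
  from has_integral_linear[OF this bounded_linear_of_real]
  have "((\<lambda>t. if t \<in> {c..x} then (of_real \<circ> (\<lambda>t. (t - c) ^ n / fact n)) t else 0) has_integral
      (of_real ((x - c) ^ Suc n / fact (Suc n)) :: 'k)) {0..x}"
    using assms
    by (subst has_integral_restrict) (auto simp del: of_real_divide of_real_power of_real_diff)
  then have "((\<lambda>t. if c \<le> t then of_real ((t - c) ^ n / fact n) else 0) has_integral
      (of_real ((x - c) ^ Suc n / fact (Suc n)) :: 'k)) {0..x}"
    by (rule has_integral_eq[rotated]) auto
  with True show ?thesis by (simp only: if_True)
qed

lemma volterra_ramp:
  assumes "0 \<le> c"
  shows "volterra (ramp c n :: 'k::{real_normed_field, euclidean_space} L2) = ramp c (Suc n)"
  using assms unfolding volterra.rep_eq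
proof transfer
  fix c :: real and n
  let ?r = "\<lambda>n x. if c \<le> x then of_real ((x - c) ^ n / fact n) else 0 :: 'k"
  assume c: "0 \<le> c"
  have "(\<integral>t. ?r n t \<partial>lebesgue_on {0..x}) = ?r (Suc n) x" if "x \<in> {0..1}" for x
    using unit_integral_restrict(2)[OF square_integrable_unit_integrable(1)[OF
          ramp_square_integrable[where 'k = 'k, of c n]] that]
      integral_unique[OF ramp_has_integral[where 'k = 'k, OF c, of n x]] by (simp only:)
  then have "AE x in unit_measure. (\<integral>t. ?r n t \<partial>lebesgue_on {0..x}) = ?r (Suc n) x"
    by (intro AE_I2) (simp only: space_restrict_space, simp)
  then show "L2_rel (\<lambda>x. \<integral>t. ?r n t \<partial>lebesgue_on {0..x}) (?r (Suc n))"
    by (simp only: L2_rel_def ramp_square_integrable volterra_square_integrable(1) simp_thms)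
qed

lemma volterra_power_ramp:
  "0 \<le> c \<Longrightarrow> blinfun_power volterra m (ramp c n) = ramp c (n + m)"
  by (induction m) (auto simp: volterra_ramp)

lemma norm_cutoff_ramp_le:
  assumes "0 \<le> c" "c \<le> b"
  shows "norm (cutoff b (ramp c n :: 'k::{real_normed_field, euclidean_space} L2)) \<le> (b - c) ^ n / fact n"
  using assms unfolding cutoff.rep_eq
proof transfer
  fix b c :: real and n
  let ?r = "\<lambda>x. if c \<le> x then of_real ((x - c) ^ n / fact n) else 0 :: 'k"
  assume c: "0 \<le> c" "c \<le> b"
  show "norm2 unit_measure (\<lambda>x. if x \<le> b then ?r x else 0) \<le> (b - c) ^ n / fact n"
  proof (rule norm2_unit_le_const[OF cutoff_square_integrable(1)[OF ramp_square_integrable]])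
    show "AE x in unit_measure. norm (if x \<le> b then ?r x else 0) \<le> (b - c) ^ n / fact n"
    proof (rule AE_I2)
      fix x
      have "norm (of_real ((x - c) ^ n / fact n) :: 'k) \<le> (b - c) ^ n / fact n" if "c \<le> x" "x \<le> b"
        unfolding norm_of_real using that by (auto intro!: divide_right_mono power_mono)
      then show "norm (if x \<le> b then ?r x else 0) \<le> (b - c) ^ n / fact n"
        using c by (auto simp del: of_real_divide of_real_power of_real_diff)
    qed
  qed (use c in auto)
qed

lemma norm_ramp_ge:
  assumes "0 \<le> c" "c \<le> 1"
  shows "(1 - c) ^ Suc n / fact (Suc n) \<le> norm (ramp c n :: 'k::{real_normed_field, euclidean_space} L2)"
  using assms
proof transfer
  fix c :: real and n
  let ?r = "\<lambda>x. if c \<le> x then of_real ((x - c) ^ n / fact n) else 0 :: 'k"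
  assume c: "0 \<le> c" "c \<le> 1"
  have "(\<integral>x. norm (?r x) \<partial>unit_measure) = integral {0..1} (\<lambda>x. norm (?r x))"
    by (rule lebesgue_integral_eq_integral)
      (use square_integrable_unit_integrable(1)[OF ramp_square_integrable, of c n] in auto)
  also have "\<dots> = integral {0..1} (\<lambda>x. if c \<le> x then of_real ((x - c) ^ n / fact n) else 0)"
    by (rule arg_cong[where f = "integral _"])
      (auto simp: fun_eq_iff simp del: of_real_divide of_real_power of_real_diff)
  also have "\<dots> = (1 - c) ^ Suc n / fact (Suc n)"
    using integral_unique[OF ramp_has_integral[where 'k = real, OF c(1), of n 1]] c by simp
  finally show "(1 - c) ^ Suc n / fact (Suc n) \<le> norm2 unit_measure ?r"
    using square_integrable_unit_integrable(2)[OF ramp_square_integrable[where 'k = 'k, of c n]] by simp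
qed


section \<open>Positivity of the Volterra operator\<close>

lemma integral_nonneg_scalars:
  fixes f :: "real \<Rightarrow> 'k::{real_normed_field, euclidean_space}"
  assumes f: "f \<in> square_integrable unit_measure" and nn: "AE x in unit_measure. f x \<in> \<real>\<^sub>\<ge>\<^sub>0"
    and x: "x \<in> {0..1}"
  shows "(\<integral>t. f t \<partial>lebesgue_on {0..x}) = of_real (\<integral>t. norm (f t) \<partial>lebesgue_on {0..x})"
proof -
  note int = unit_integral_restrict(1)[OF square_integrable_unit_integrable(1)[OF f] x]
  have "AE t in lebesgue. t \<in> {0..1} \<longrightarrow> f t \<in> \<real>\<^sub>\<ge>\<^sub>0"
    using nn by (simp only: AE_unit_iff)
  then have "AE t in lebesgue. t \<in> {0..x} \<longrightarrow> f t = of_real (norm (f t))"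
    by eventually_elim (use x in \<open>auto simp: nonneg_Reals_def\<close>)
  then have "AE t in lebesgue_on {0..x}. f t = of_real (norm (f t))"
    by (subst AE_restrict_space_iff) auto
  then have "(\<integral>t. f t \<partial>lebesgue_on {0..x}) = (\<integral>t. of_real (norm (f t)) \<partial>lebesgue_on {0..x})"
    using int by (intro integral_cong_AE) auto
  also have "\<dots> = of_real (\<integral>t. norm (f t) \<partial>lebesgue_on {0..x})"
    using int by (intro integral_bounded_linear[OF bounded_linear_of_real]) auto
  finally show ?thesis .
qed

text \<open>By the Cauchy--Schwarz inequality the integral of \<open>f\<close> over \<open>[0,x]\<close> is at most \<open>\<parallel>f\<parallel>\<close>.\<close>

lemma volterra_le:
  fixes f :: "'k::{real_normed_field, euclidean_space} L2"
  assumes "0 \<le> f"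
  shows "volterra f \<le> norm f *\<^sub>R ramp 0 0"
  using assms unfolding volterra.rep_eq
proof transfer
  fix f :: "real \<Rightarrow> 'k"
  assume "L2_rel f f" and nn: "AE x in unit_measure. f x - 0 \<in> \<real>\<^sub>\<ge>\<^sub>0"
  then have f: "f \<in> square_integrable unit_measure" by (simp add: L2_rel_def)
  note fi = square_integrable_unit_integrable[OF f]
  have "norm2 unit_measure f *\<^sub>R (if 0 \<le> x then of_real ((x - 0) ^ 0 / fact 0) else 0)
      - (\<integral>t. f t \<partial>lebesgue_on {0..x}) \<in> \<real>\<^sub>\<ge>\<^sub>0" if x: "x \<in> {0..1}" for x
  proof -
    have eq: "(\<integral>t. f t \<partial>lebesgue_on {0..x}) = of_real (\<integral>t. norm (f t) \<partial>lebesgue_on {0..x})"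
      using integral_nonneg_scalars[OF f _ x] nn by simp
    have "norm (\<integral>t. f t \<partial>lebesgue_on {0..x}) \<le> norm2 unit_measure f"
      using unit_integral_restrict(3)[OF fi(1) x] fi(2) by simp
    then have "(\<integral>t. norm (f t) \<partial>lebesgue_on {0..x}) \<le> norm2 unit_measure f"
      unfolding eq norm_of_real by simp
    then show ?thesis
      unfolding eq using x by (simp add: scaleR_conv_of_real flip: of_real_diff)
  qed
  then show "AE x in unit_measure. norm2 unit_measure f *\<^sub>R (if 0 \<le> x then of_real ((x - 0) ^ 0 / fact 0) else 0)
      - (\<integral>t. f t \<partial>lebesgue_on {0..x}) \<in> \<real>\<^sub>\<ge>\<^sub>0"
    by (intro AE_I2) simp
qed

text \<open>The witness \<open>\<delta>\<close> is the integral of \<open>f\<close> over \<open>[0,c]\<close>.\<close>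

lemma volterra_ge:
  fixes f :: "'k::{real_normed_field, euclidean_space} L2"
  assumes "0 \<le> f" "0 \<le> c" "c \<le> 1"
  shows "\<exists>\<delta>\<ge>0. \<delta> *\<^sub>R ramp c 0 \<le> volterra f \<and> (\<delta> = 0 \<longrightarrow> cutoff c f = 0)"
  using assms unfolding volterra.rep_eq cutoff.rep_eq
proof transfer
  fix f :: "real \<Rightarrow> 'k" and c :: real
  assume "L2_rel f f" and nn: "AE x in unit_measure. f x - 0 \<in> \<real>\<^sub>\<ge>\<^sub>0" and c: "0 \<le> c" "c \<le> 1"
  then have f: "f \<in> square_integrable unit_measure" by (simp add: L2_rel_def)
  note fi = square_integrable_unit_integrable(1)[OF f]
  define I where "I x = (\<integral>t. norm (f t) \<partial>lebesgue_on {0..x})" for x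
  have I0: "0 \<le> I x" for x by (simp add: I_def)
  have I_mono: "I c \<le> I x" if "c \<le> x" "x \<le> 1" for x
  proof -
    have "I y = integral {0..y} (\<lambda>t. norm (f t))" and "(\<lambda>t. norm (f t)) integrable_on {0..y}"
      if "y \<in> {0..1}" for y
      using unit_integral_restrict(1,2)[OF integrable_norm[OF fi] that]
      by (auto simp: I_def intro: integrable_on_lebesgue_on)
    then show ?thesis using that c by (auto intro!: integral_subset_le)
  qed
  show "\<exists>\<delta>\<ge>0. (AE x in unit_measure. (\<integral>t. f t \<partial>lebesgue_on {0..x})
        - \<delta> *\<^sub>R (if c \<le> x then of_real ((x - c) ^ 0 / fact 0) else 0) \<in> \<real>\<^sub>\<ge>\<^sub>0) \<and>
      (\<delta> = 0 \<longrightarrow> L2_rel (\<lambda>x. if x \<le> c then f x else 0) (\<lambda>x. 0))"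
  proof (intro exI[of _ "I c"] conjI I0 impI)
    have "(\<integral>t. f t \<partial>lebesgue_on {0..x})
        - I c *\<^sub>R (if c \<le> x then of_real ((x - c) ^ 0 / fact 0) else 0) \<in> \<real>\<^sub>\<ge>\<^sub>0" if x: "x \<in> {0..1}" for x
    proof -
      have eq: "(\<integral>t. f t \<partial>lebesgue_on {0..x}) = of_real (I x)"
        using integral_nonneg_scalars[OF f _ x] nn by (simp add: I_def)
      show ?thesis
        unfolding eq using x I0[of x] I_mono[of x] by (auto simp: scaleR_conv_of_real simp flip: of_real_diff)
    qed
    then show "AE x in unit_measure. (\<integral>t. f t \<partial>lebesgue_on {0..x})
        - I c *\<^sub>R (if c \<le> x then of_real ((x - c) ^ 0 / fact 0) else 0) \<in> \<real>\<^sub>\<ge>\<^sub>0"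
      by (intro AE_I2) simp
    assume "I c = 0"
    then have "AE t in lebesgue_on {0..c}. norm (f t) = 0"
      unfolding I_def using unit_integral_restrict(1)[OF integrable_norm[OF fi], of c] c
      by (subst (asm) integral_nonneg_eq_0_iff_AE) auto
    then have "AE t in lebesgue. t \<in> {0..c} \<longrightarrow> norm (f t) = 0"
      by (subst (asm) AE_restrict_space_iff) auto
    then have "AE x in unit_measure. (if x \<le> c then f x else 0) = 0"
      unfolding AE_unit_iff by eventually_elim auto
    then show "L2_rel (\<lambda>x. if x \<le> c then f x else 0) (\<lambda>x. 0)"
      using f by (simp add: L2_rel_def cutoff_square_integrable square_integrable_zero)
  qed
qed

lemma volterra_positive:
  "volterra \<in> positive_operators (scale_L2 :: 'k::{real_normed_field, euclidean_space} \<Rightarrow> _)"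
  unfolding positive_operators_def
proof (intro CollectI conjI allI impI)
  show "(volterra :: 'k L2 \<Rightarrow>\<^sub>L 'k L2) \<in> bounded_operators scale_L2"
    unfolding L2.bounded_operators_iff volterra.rep_eq
    by transfer (auto simp: L2_rel_def intro!: square_integrable_scale volterra_square_integrable)
  show "0 \<le> volterra f" if f: "0 \<le> f" for f :: "'k L2"
  proof -
    obtain \<delta> where "\<delta> \<ge> 0" "\<delta> *\<^sub>R ramp 0 0 \<le> volterra f"
      using volterra_ge[OF f, of 0] by auto
    then show ?thesis by (meson order_trans scaleR_nonneg_nonneg ramp_nonneg)
  qed
qed


section \<open>The super commutants of the Volterra operator\<close>

text \<open>
  Let \<open>V B \<le> B V\<close> and let \<open>g = B 1\<^bsub>[a,1]\<^esub>\<close> have the integral \<open>\<delta>\<close> over \<open>[0,c]\<close>, where \<open>c < a\<close>.  Then \<open>V\<^sup>n\<^sup>+\<^sup>1 g\<close>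
  dominates the \<open>n\<close>-fold integral of \<open>\<delta> 1\<^bsub>[c,1]\<^esub>\<close>, of norm at least \<open>\<delta> (1 - c)\<^sup>n\<^sup>+\<^sup>1 / (n + 1)!\<close>.  It is itself
  dominated by \<open>B\<close> applied to the \<open>(n + 1)\<close>-fold integral of \<open>1\<^bsub>[a,1]\<^esub>\<close>, of norm at most
  \<open>\<parallel>B\<parallel> (1 - a)\<^sup>n\<^sup>+\<^sup>1 / (n + 1)!\<close>.  As \<open>1 - a < 1 - c\<close>, letting \<open>n \<rightarrow> \<infinity>\<close> forces \<open>\<delta> = 0\<close>.
\<close>

lemma super_right_commutant_cutoff_ramp:
  fixes B :: "'k::{real_normed_field, euclidean_space} L2 \<Rightarrow>\<^sub>L 'k L2"
  assumes B: "B \<in> super_right_commutant scale_L2 volterra" and a: "0 \<le> a" "a \<le> 1"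
  shows "cutoff a (B (ramp a 0)) = 0"
proof (rule cutoff_eq_0_of_smaller)
  fix c assume c: "0 \<le> c" "c < a"
  have Bpos: "B \<in> positive_operators scale_L2" using B by (simp add: super_right_commutant_def)
  define g where "g = B (ramp a 0)"
  have g: "0 \<le> g" unfolding g_def by (rule positive_operators_nonneg[OF Bpos ramp_nonneg])
  obtain \<delta> where \<delta>: "\<delta> \<ge> 0" "\<delta> *\<^sub>R ramp c 0 \<le> volterra g" "\<delta> = 0 \<longrightarrow> cutoff c g = 0"
    using volterra_ge[OF g c(1)] c a by auto
  define q where "q = (1 - a) / (1 - c)"
  have q: "0 \<le> q" "q < 1" using c a by (auto simp: q_def divide_simps)
  have "\<delta> \<le> norm B * q ^ Suc n" for n
  proof -
    have "\<delta> *\<^sub>R ramp c n = blinfun_power volterra n (\<delta> *\<^sub>R ramp c 0)"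
      by (simp add: blinfun.scaleR_right volterra_power_ramp[OF c(1)])
    also have "\<dots> \<le> blinfun_power volterra n (volterra g)"
      by (rule positive_power_mono[OF volterra_positive \<delta>(2)])
    also have "\<dots> = blinfun_power volterra (Suc n) g"
      by (simp add: blinfun_power_Suc_right del: blinfun_power_Suc_apply)
    also have "\<dots> \<le> B (blinfun_power volterra (Suc n) (ramp a 0))"
      unfolding g_def by (rule super_right_commutant_power[OF volterra_positive B ramp_nonneg])
    also have "\<dots> = B (ramp a (Suc n))"
      by (simp only: volterra_power_ramp[OF a(1)] add_0)
    finally have "norm (\<delta> *\<^sub>R ramp c n :: 'k L2) \<le> norm (B (ramp a (Suc n)))"
      using \<delta>(1) ramp_nonneg by (intro norm_L2_mono scaleR_nonneg_nonneg)
    also have "\<dots> \<le> norm B * norm (ramp a (Suc n) :: 'k L2)" by (rule norm_blinfun)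
    also have "\<dots> \<le> norm B * ((1 - a) ^ Suc n / fact (Suc n))"
      using norm_cutoff_ramp_le[OF a, of "Suc n", where 'k = 'k] by (intro mult_left_mono) (simp_all add: cutoff_1)
    finally have "\<delta> * norm (ramp c n :: 'k L2) \<le> norm B * ((1 - a) ^ Suc n / fact (Suc n))"
      using \<delta>(1) by simp
    moreover have "\<delta> * ((1 - c) ^ Suc n / fact (Suc n)) \<le> \<delta> * norm (ramp c n :: 'k L2)"
      using c a \<delta>(1) by (intro mult_left_mono norm_ramp_ge) auto
    ultimately have "\<delta> * ((1 - c) ^ Suc n / fact (Suc n)) \<le> norm B * ((1 - a) ^ Suc n / fact (Suc n))"
      by linarith
    then have "\<delta> * (1 - c) ^ Suc n \<le> norm B * (1 - a) ^ Suc n"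
      by (simp add: divide_le_cancel del: power_Suc fact_Suc)
    moreover have "(1 - c) ^ Suc n > 0" using c a by (intro zero_less_power) auto
    ultimately show ?thesis by (simp add: q_def power_divide field_simps del: power_Suc)
  qed
  moreover have "(\<lambda>n. norm B * q ^ Suc n) \<longlonglongrightarrow> 0"
    using q by (intro tendsto_mult_right_zero LIMSEQ_Suc LIMSEQ_realpow_zero)
  ultimately have "\<delta> \<le> 0" by (intro LIMSEQ_le_const) auto
  with \<delta> show "cutoff c (B (ramp a 0)) = 0" by (auto simp: g_def)
qed

text \<open>
  If \<open>B V \<le> V B\<close>, use that \<open>1\<^bsub>[a,1]\<^esub>\<close> is at most \<open>(x/a)\<^sup>m\<close>, a multiple of \<open>V\<^sup>m 1\<close>.  Hence \<open>B 1\<^bsub>[a,1]\<^esub>\<close> is at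
  most the same multiple of \<open>V\<^sup>m B 1\<close>, which on \<open>[0,c]\<close> is \<open>O(m (c/a)\<^sup>m)\<close> and so tends to \<open>0\<close> if \<open>c < a\<close>.
\<close>

lemma super_left_commutant_cutoff_ramp:
  fixes B :: "'k::{real_normed_field, euclidean_space} L2 \<Rightarrow>\<^sub>L 'k L2"
  assumes B: "B \<in> super_left_commutant scale_L2 volterra" and a: "0 \<le> a"
  shows "cutoff a (B (ramp a 0)) = 0"
proof (rule cutoff_eq_0_of_smaller)
  fix c assume c: "0 \<le> c" "c < a"
  have Bpos: "B \<in> positive_operators scale_L2" using B by (simp add: super_left_commutant_def)
  define g where "g = B (ramp a 0)"
  have g: "0 \<le> g" unfolding g_def by (rule positive_operators_nonneg[OF Bpos ramp_nonneg])
  define h where "h = B (ramp 0 0)"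
  have h: "0 \<le> h" unfolding h_def by (rule positive_operators_nonneg[OF Bpos ramp_nonneg])
  have "norm (cutoff c g) \<le> norm h / a * (real (Suc n) * (c / a) ^ n)" for n
  proof -
    define K where "K = fact (Suc n) / a ^ Suc n"
    have K: "K \<ge> 0" using c by (simp add: K_def)
    have "(ramp a 0 :: 'k L2) \<le> K *\<^sub>R ramp 0 (Suc n)"
      using c(1,2) unfolding K_def
    proof (transfer, intro AE_I2)
      fix a c :: real and n x assume ca: "0 \<le> c" "c < a" and x: "x \<in> space unit_measure"
      have x0: "0 \<le> x" using x by simp
      define t where "t = (x / a) ^ Suc n"
      have t: "(fact (Suc n) / a ^ Suc n) * (x ^ Suc n / fact (Suc n)) = t"
        by (simp add: t_def power_divide del: power_Suc fact_Suc)
      have "1 \<le> t" if "a \<le> x"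
        unfolding t_def using ca that by (intro one_le_power) auto
      moreover have "0 \<le> t"
        unfolding t_def using ca x by (intro zero_le_power) auto
      ultimately have nn: "0 \<le> t - (if a \<le> x then 1 else 0)" by simp
      have "(fact (Suc n) / a ^ Suc n) *\<^sub>R (if 0 \<le> x then of_real ((x - 0) ^ Suc n / fact (Suc n)) else 0)
          = (of_real t :: 'k)"
        by (simp only: x0 if_True scaleR_conv_of_real of_real_mult[symmetric] t diff_zero)
      moreover have "(if a \<le> x then of_real ((x - a) ^ 0 / fact 0) else 0 :: 'k) = of_real (if a \<le> x then 1 else 0)"
        by simp
      ultimately show "(fact (Suc n) / a ^ Suc n) *\<^sub>R (if 0 \<le> x then of_real ((x - 0) ^ Suc n / fact (Suc n)) else 0)
          - (if a \<le> x then of_real ((x - a) ^ 0 / fact 0) else 0) \<in> (\<real>\<^sub>\<ge>\<^sub>0 :: 'k set)"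
        using nn by (simp only: of_real_diff[symmetric] nonneg_Reals_of_real_iff)
    qed
    then have "g \<le> B (K *\<^sub>R ramp 0 (Suc n))"
      unfolding g_def by (rule positive_operators_mono[OF Bpos])
    also have "\<dots> = K *\<^sub>R B (blinfun_power volterra (Suc n) (ramp 0 0))"
      by (simp only: blinfun.scaleR_right volterra_power_ramp order_refl add_0)
    also have "\<dots> \<le> K *\<^sub>R blinfun_power volterra (Suc n) h"
      unfolding h_def
      by (intro scaleR_left_mono K super_left_commutant_power[OF volterra_positive B ramp_nonneg])
    also have "blinfun_power volterra (Suc n) h = blinfun_power volterra n (volterra h)"
      by (simp add: blinfun_power_Suc_right del: blinfun_power_Suc_apply)
    also have "K *\<^sub>R blinfun_power volterra n (volterra h)
        \<le> K *\<^sub>R blinfun_power volterra n (norm h *\<^sub>R ramp 0 0)"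
      by (intro scaleR_left_mono K positive_power_mono[OF volterra_positive] volterra_le h)
    also have "\<dots> = (K * norm h) *\<^sub>R ramp 0 n"
      by (simp add: blinfun.scaleR_right volterra_power_ramp)
    finally have "cutoff c g \<le> (K * norm h) *\<^sub>R cutoff c (ramp 0 n)"
      using positive_operators_mono[OF cutoff_positive, of g "(K * norm h) *\<^sub>R ramp 0 n" c]
      by (simp add: blinfun.scaleR_right)
    then have "norm (cutoff c g) \<le> norm ((K * norm h) *\<^sub>R cutoff c (ramp 0 n :: 'k L2))"
      by (intro norm_L2_mono positive_operators_nonneg[OF cutoff_positive] g)
    also have "\<dots> = K * norm h * norm (cutoff c (ramp 0 n :: 'k L2))" using K by simp
    also have "\<dots> \<le> K * norm h * (c ^ n / fact n)"
      using norm_cutoff_ramp_le[of 0 c n, where 'k = 'k] c K by (intro mult_left_mono) auto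
    also have "\<dots> = norm h / a * (real (Suc n) * (c / a) ^ n)"
      using c by (simp add: K_def power_divide field_simps)
    finally show ?thesis .
  qed
  moreover have "(\<lambda>n. norm h / a * (real (Suc n) * (c / a) ^ n)) \<longlonglongrightarrow> 0"
  proof -
    have q: "norm (c / a) < 1" using c by simp
    have "(\<lambda>n. real n * (c / a) ^ n + (c / a) ^ n) \<longlonglongrightarrow> 0 + 0"
      using q by (intro tendsto_add powser_times_n_limit_0 LIMSEQ_power_zero)
    then show ?thesis by (intro tendsto_mult_right_zero) (simp add: algebra_simps)
  qed
  ultimately have "norm (cutoff c g) \<le> 0" by (intro LIMSEQ_le_const) auto
  then show "cutoff c (B (ramp a 0)) = 0" by (simp add: g_def)
qed

lemma abs_L2_sum:
  fixes f :: "'i \<Rightarrow> real \<Rightarrow> 'k::{real_normed_field, euclidean_space}"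
  assumes "finite I" "\<And>i. i \<in> I \<Longrightarrow> f i \<in> square_integrable unit_measure"
  shows "(\<lambda>x. \<Sum>i\<in>I. f i x) \<in> square_integrable unit_measure \<and>
    (\<Sum>i\<in>I. abs_L2 (f i)) = abs_L2 (\<lambda>x. \<Sum>i\<in>I. f i x)"
  using assms
proof (induction I rule: finite_induct)
  case empty
  then show ?case by (simp add: square_integrable_zero zero_L2_def)
next
  case (insert i I)
  then have "L2_rel (f i) (f i)" "L2_rel (\<lambda>x. \<Sum>i\<in>I. f i x) (\<lambda>x. \<Sum>i\<in>I. f i x)"
    by (auto simp: L2_rel_def)
  from plus_L2.abs_eq[OF this] insert show ?case
    by (auto intro!: square_integrable_add)
qed

text \<open>
  A bounded function with values in the scalar field is a combination of nonnegative bounded functions,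
  with the elements of an \<open>\<real>\<close>-basis of the field as coefficients.
\<close>

lemma bounded_function_decomposition:
  fixes f :: "real \<Rightarrow> 'k::{real_normed_field, euclidean_space}"
  assumes f: "f \<in> square_integrable unit_measure" and K: "\<And>x. norm (f x) \<le> K"
    and supp: "\<And>x. x < a \<Longrightarrow> f x = 0"
  obtains u v where "abs_L2 f = (\<Sum>b\<in>Basis. scale_L2 b (u b - v b))"
    "\<forall>b\<in>Basis. 0 \<le> u b \<and> u b \<le> K *\<^sub>R ramp a 0"
    "\<forall>b\<in>Basis. 0 \<le> v b \<and> v b \<le> K *\<^sub>R ramp a 0"
proof
  define p where "p b x = (of_real (max 0 (f x \<bullet> b)) :: 'k)" for b x
  have f_meas [measurable]: "f \<in> borel_measurable unit_measure" using f by measurable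
  have sq: "p b \<in> square_integrable unit_measure" if "norm b = 1" for b
  proof (rule square_integrable_dominated[OF f])
    show "p b \<in> borel_measurable unit_measure" unfolding p_def by measurable
    show "AE x in unit_measure. norm (p b x) \<le> norm (f x)"
      using Cauchy_Schwarz_ineq2[of _ b] that by (intro AE_I2) (auto simp: p_def max_def abs_le_iff)
  qed
  have bounds: "0 \<le> abs_L2 (p b) \<and> abs_L2 (p b) \<le> K *\<^sub>R ramp a 0" if "norm b = 1" for b
  proof -
    have rel: "L2_rel (p b) (p b)" using sq[OF that] by (simp add: L2_rel_def)
    have r: "L2_rel (\<lambda>x. if a \<le> x then of_real ((x - a) ^ 0 / fact 0) else 0 :: 'k)
        (\<lambda>x. if a \<le> x then of_real ((x - a) ^ 0 / fact 0) else 0)"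
      using ramp_square_integrable[of a 0] by (simp only: L2_rel_def) simp
    have le: "max 0 (f x \<bullet> b) \<le> K" for x
      using Cauchy_Schwarz_ineq2[of "f x" b] K[of x] that norm_ge_zero[of "f x"] by auto
    have "0 \<le> abs_L2 (p b)"
      unfolding zero_L2_def
      by (subst less_eq_L2.abs_eq[OF _ rel]) (auto simp: L2_rel_def square_integrable_zero p_def)
    moreover have "abs_L2 (p b) \<le> K *\<^sub>R ramp a 0"
      unfolding ramp_def
    proof (simp only: map_fun_def o_def id_apply, subst scaleR_L2.abs_eq[OF r], subst less_eq_L2.abs_eq[OF rel])
      show "L2_rel (\<lambda>x. K *\<^sub>R (if a \<le> x then of_real ((x - a) ^ 0 / fact 0) else 0 :: 'k))
          (\<lambda>x. K *\<^sub>R (if a \<le> x then of_real ((x - a) ^ 0 / fact 0) else 0))"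
        using r by (auto simp: L2_rel_def intro: square_integrable_scaleR)
      show "AE x in unit_measure. K *\<^sub>R (if a \<le> x then of_real ((x - a) ^ 0 / fact 0) else 0) - p b x \<in> \<real>\<^sub>\<ge>\<^sub>0"
        using le supp by (intro AE_I2)
          (auto simp: p_def scaleR_conv_of_real not_le simp flip: of_real_diff)
    qed
    ultimately show ?thesis ..
  qed
  show "\<forall>b\<in>Basis. 0 \<le> abs_L2 (p b) \<and> abs_L2 (p b) \<le> K *\<^sub>R ramp a 0"
    using bounds by simp
  show "\<forall>b\<in>Basis. 0 \<le> abs_L2 (p (- b)) \<and> abs_L2 (p (- b)) \<le> K *\<^sub>R ramp a 0"
    using bounds by simp
  have sq_b: "(\<lambda>x. b * (p b x - p (- b) x)) \<in> square_integrable unit_measure" if "b \<in> Basis" for b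
    using that by (intro square_integrable_scale square_integrable_diff sq) auto
  have "(\<Sum>b\<in>Basis. scale_L2 b (abs_L2 (p b) - abs_L2 (p (- b))))
      = (\<Sum>b\<in>Basis. abs_L2 (\<lambda>x. b * (p b x - p (- b) x)))"
  proof (rule sum.cong[OF refl])
    fix b :: 'k assume "b \<in> Basis"
    then have *: "L2_rel (p b) (p b)" "L2_rel (p (- b)) (p (- b))"
      using sq by (auto simp: L2_rel_def)
    then have "L2_rel (\<lambda>x. p b x - p (- b) x) (\<lambda>x. p b x - p (- b) x)"
      by (auto simp: L2_rel_def intro: square_integrable_diff)
    with * show "scale_L2 b (abs_L2 (p b) - abs_L2 (p (- b))) = abs_L2 (\<lambda>x. b * (p b x - p (- b) x))"
      by (simp add: minus_L2.abs_eq scale_L2.abs_eq)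
  qed
  also have "\<dots> = abs_L2 (\<lambda>x. \<Sum>b\<in>Basis. b * (p b x - p (- b) x))"
    by (rule abs_L2_sum[where f = "\<lambda>b x. b * (p b x - p (- b) x)", OF finite_Basis sq_b, THEN conjunct2])
  also have "(\<lambda>x. \<Sum>b\<in>Basis. b * (p b x - p (- b) x)) = f"
  proof
    fix x
    have "b * (p b x - p (- b) x) = (f x \<bullet> b) *\<^sub>R b" for b
    proof -
      have "max 0 (f x \<bullet> b) - max 0 (- (f x \<bullet> b)) = f x \<bullet> b" by auto
      then show ?thesis
        by (simp only: p_def inner_minus_right of_real_diff[symmetric] scaleR_conv_of_real mult.commute)
    qed
    then show "(\<Sum>b\<in>Basis. b * (p b x - p (- b) x)) = f x" by (simp add: euclidean_representation)
  qed
  finally show "abs_L2 f = (\<Sum>b\<in>Basis. scale_L2 b (abs_L2 (p b) - abs_L2 (p (- b))))" ..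
qed

lemma truncation_tendsto:
  fixes f :: "real \<Rightarrow> 'k::{real_normed_field, euclidean_space}"
  assumes f: "f \<in> square_integrable unit_measure"
  shows "(\<lambda>x. if norm (f x) \<le> real n then f x else 0) \<in> square_integrable unit_measure"
    and "(\<lambda>n. abs_L2 (\<lambda>x. if norm (f x) \<le> real n then f x else 0)) \<longlonglongrightarrow> abs_L2 f"
proof -
  let ?f = "\<lambda>n x. if norm (f x) \<le> real n then f x else 0"
  have [measurable]: "f \<in> borel_measurable unit_measure" using f by measurable
  show sq: "?f n \<in> square_integrable unit_measure" for n
    by (rule square_integrable_dominated[OF f]) auto
  have "norm (abs_L2 (?f n) - abs_L2 f) = norm2 unit_measure (\<lambda>x. ?f n x - f x)" for n
    using sq[of n] f
    by (subst minus_L2.abs_eq) (auto simp: L2_rel_def norm_L2.abs_eq square_integrable_diff)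
  moreover have "(\<lambda>n. norm2 unit_measure (\<lambda>x. ?f n x - f x)) \<longlonglongrightarrow> 0"
  proof -
    have "(\<lambda>n. \<integral>x. (norm (?f n x - f x))\<^sup>2 \<partial>unit_measure) \<longlonglongrightarrow> (\<integral>x. 0 \<partial>unit_measure)"
    proof (rule integral_dominated_convergence[where w = "\<lambda>x. (norm (f x))\<^sup>2"])
      show "AE x in unit_measure. (\<lambda>n. (norm (?f n x - f x))\<^sup>2) \<longlonglongrightarrow> 0"
      proof (rule AE_I2)
        fix x
        obtain N where "norm (f x) \<le> real N" using real_arch_simple by blast
        then have "\<forall>\<^sub>F n in sequentially. (norm (?f n x - f x))\<^sup>2 = 0"
          by (intro eventually_sequentiallyI[of N]) auto
        then show "(\<lambda>n. (norm (?f n x - f x))\<^sup>2) \<longlonglongrightarrow> 0" by (rule tendsto_eventually)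
      qed
    qed (use square_integrable_integrable[OF f] in auto)
    from tendsto_real_sqrt[OF this] show ?thesis by (simp add: norm2_def)
  qed
  ultimately show "(\<lambda>n. abs_L2 (?f n)) \<longlonglongrightarrow> abs_L2 f"
    by (subst LIM_zero_iff[symmetric], subst tendsto_norm_zero_iff[symmetric]) simp
qed

text \<open>
  As \<open>B 1\<^bsub>[a,1]\<^esub>\<close> lies in \<open>L\<^sup>2[a,1]\<close>, by positivity \<open>B\<close> maps everything between \<open>0\<close> and a multiple of \<open>1\<^bsub>[a,1]\<^esub>\<close> into
  \<open>L\<^sup>2[a,1]\<close>, by linearity all bounded functions that vanish on \<open>[0,a]\<close>, and by continuity their limits, which are all of \<open>L\<^sup>2[a,1]\<close>.
\<close>

lemma cutoff_invariant_of_ramp: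
  fixes B :: "'k::{real_normed_field, euclidean_space} L2 \<Rightarrow>\<^sub>L 'k L2"
  assumes B: "B \<in> positive_operators scale_L2" and ramp: "cutoff a (B (ramp a 0)) = 0"
  shows "cutoff a o\<^sub>L B o\<^sub>L cutoff a = cutoff a o\<^sub>L B"
proof -
  have dominated: "cutoff a (B h) = 0" if "0 \<le> h" "h \<le> K *\<^sub>R ramp a 0" for h K
  proof (rule antisym)
    show "0 \<le> cutoff a (B h)"
      by (intro positive_operators_nonneg[OF cutoff_positive] positive_operators_nonneg[OF B] that)
    have "cutoff a (B h) \<le> cutoff a (B (K *\<^sub>R ramp a 0))"
      by (intro positive_operators_mono[OF cutoff_positive] positive_operators_mono[OF B] that)
    then show "cutoff a (B h) \<le> 0" by (simp add: blinfun.scaleR_right ramp)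
  qed
  have bounded: "cutoff a (B (abs_L2 f)) = 0"
    if f: "f \<in> square_integrable unit_measure" "\<And>x. norm (f x) \<le> K" "\<And>x. x < a \<Longrightarrow> f x = 0" for f K
  proof -
    obtain u v where uv: "abs_L2 f = (\<Sum>b\<in>Basis. scale_L2 b (u b - v b))"
      "\<forall>b\<in>Basis. 0 \<le> u b \<and> u b \<le> K *\<^sub>R ramp a 0"
      "\<forall>b\<in>Basis. 0 \<le> v b \<and> v b \<le> K *\<^sub>R ramp a 0"
      by (rule bounded_function_decomposition[OF f]) blast
    have "cutoff a (B (scale_L2 b (u b - v b))) = 0" if "b \<in> Basis" for b
      using bspec[OF uv(2) that] bspec[OF uv(3) that] dominated[of "u b" K] dominated[of "v b" K]
      by (simp add: L2.bounded_operators_scale[OF positive_operators_bounded[OF B]]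
          L2.bounded_operators_scale[OF cutoff_mem_bounded_operators] blinfun.diff_right)
    then show ?thesis unfolding uv(1) by (simp add: blinfun.sum_right)
  qed
  have "cutoff a (B (f - cutoff a f)) = 0" for f
  proof -
    define r where "r = rep_L2 f"
    have rel: "L2_rel r r" and f: "f = abs_L2 r"
      unfolding r_def
      by (rule Quotient3_rep_reflp[OF Quotient3_L2], rule Quotient3_abs_rep[OF Quotient3_L2, symmetric])
    define g where "g x = r x - (if x \<le> a then r x else 0)" for x
    have g: "g \<in> square_integrable unit_measure"
      using rel unfolding g_def L2_rel_def by (intro square_integrable_diff cutoff_square_integrable) auto
    have rel_cutoff: "L2_rel (\<lambda>x. if x \<le> a then r x else 0) (\<lambda>x. if x \<le> a then r x else 0)"
      using rel by (simp add: L2_rel_def cutoff_square_integrable)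
    have "f - cutoff a f = abs_L2 g"
      by (simp only: f cutoff.rep_eq cutoff_map.abs_eq[OF rel] minus_L2.abs_eq[OF rel rel_cutoff] g_def[abs_def])
    moreover have "(\<lambda>n. cutoff a (B (abs_L2 (\<lambda>x. if norm (g x) \<le> real n then g x else 0)))) \<longlonglongrightarrow> cutoff a (B (abs_L2 g))"
      by (intro blinfun.tendsto tendsto_const truncation_tendsto g)
    moreover have "cutoff a (B (abs_L2 (\<lambda>x. if norm (g x) \<le> real n then g x else 0))) = 0" for n
      by (rule bounded[OF truncation_tendsto(1)[OF g], of n "real n"]) (auto simp: g_def)
    ultimately show ?thesis by (simp add: LIMSEQ_const_iff)
  qed
  then show ?thesis by (intro blinfun_eqI) (simp add: blinfun.diff_right)
qed

lemma volterra_super_commutants_subset_nest_algebra: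
  "super_left_commutant scale_L2 volterra \<union> super_right_commutant scale_L2 volterra
    \<subseteq> L2.nest_algebra ((cutoff :: _ \<Rightarrow> 'k::{real_normed_field, euclidean_space} L2 \<Rightarrow>\<^sub>L _) ` {0..1})"
proof
  fix B :: "'k L2 \<Rightarrow>\<^sub>L 'k L2"
  assume B: "B \<in> super_left_commutant scale_L2 volterra \<union> super_right_commutant scale_L2 volterra"
  then have Bpos: "B \<in> positive_operators scale_L2"
    by (auto simp: super_left_commutant_def super_right_commutant_def)
  have "cutoff a o\<^sub>L B o\<^sub>L cutoff a = cutoff a o\<^sub>L B" if "a \<in> {0..1}" for a
    using B super_left_commutant_cutoff_ramp[of B a] super_right_commutant_cutoff_ramp[of B a] that
    by (intro cutoff_invariant_of_ramp[OF Bpos]) auto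
  with Bpos show "B \<in> L2.nest_algebra (cutoff ` {0..1})"
    by (auto simp: L2.nest_algebra_def positive_operators_bounded)
qed

lemma norm_cutoff_diff:
  assumes "a \<le> b"
  shows "norm (cutoff b - cutoff a :: 'k L2 \<Rightarrow>\<^sub>L 'k::{real_normed_field, euclidean_space} L2) \<le> 1"
proof (rule norm_blinfun_bound)
  fix f :: "'k L2"
  have "norm (cutoff_map b f - cutoff_map a f) \<le> norm f"
    using assms
  proof transfer
    fix a b :: real and f :: "real \<Rightarrow> 'k" assume "a \<le> b" "L2_rel f f"
    then show "norm2 unit_measure (\<lambda>x. (if x \<le> b then f x else 0) - (if x \<le> a then f x else 0)) \<le> norm2 unit_measure f"
      by (intro norm2_mono_AE square_integrable_diff cutoff_square_integrable) (auto simp: L2_rel_def)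
  qed
  then show "norm ((cutoff b - cutoff a) f) \<le> 1 * norm f" by (simp add: blinfun.diff_left cutoff.rep_eq)
qed simp

text \<open>The values of \<open>V f\<close> are bounded by \<open>\<parallel>f\<parallel>\<close>, so on an interval of length \<open>h\<close> the norm of \<open>V f\<close> is at most \<open>\<surd>h \<parallel>f\<parallel>\<close>.\<close>

lemma norm_cutoff_diff_volterra:
  assumes "0 \<le> a" "a \<le> b" "b \<le> 1"
  shows "norm ((cutoff b - cutoff a) o\<^sub>L (volterra :: 'k L2 \<Rightarrow>\<^sub>L 'k::{real_normed_field, euclidean_space} L2)) \<le> sqrt (b - a)"
proof (rule norm_blinfun_bound)
  fix f :: "'k L2"
  have "norm (cutoff_map b (volterra_map f) - cutoff_map a (volterra_map f)) \<le> sqrt (b - a) * norm f"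
    using assms
  proof transfer
    fix a b :: real and f :: "real \<Rightarrow> 'k" assume ab: "0 \<le> a" "a \<le> b" "b \<le> 1" and "L2_rel f f"
    then have f: "f \<in> square_integrable unit_measure" by (simp add: L2_rel_def)
    note fi = square_integrable_unit_integrable[OF f]
    let ?F = "\<lambda>x. \<integral>t. f t \<partial>lebesgue_on {0..x}"
    let ?c = "\<lambda>x. norm2 unit_measure f * indicator {a<..b} x"
    have F: "norm (?F x) \<le> norm2 unit_measure f" if "x \<in> {0..1}" for x
      using unit_integral_restrict(3)[OF fi(1) that] fi(2) by simp
    have c_sq: "(\<lambda>x. ?c x) \<in> square_integrable unit_measure"
      by (rule square_integrable_dominated[OF square_integrable_unit_const[of "norm2 unit_measure f"]])
        (auto simp: indicator_def)
    have "norm2 unit_measure (\<lambda>x. (if x \<le> b then ?F x else 0) - (if x \<le> a then ?F x else 0)) \<le> norm2 unit_measure ?c"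
      using f F ab
      by (intro norm2_mono_AE square_integrable_diff cutoff_square_integrable volterra_square_integrable c_sq AE_I2) auto
    also have "\<dots> = sqrt (norm2 unit_measure f ^ 2 * (b - a))"
    proof -
      have "(\<integral>x. (norm (?c x))\<^sup>2 \<partial>unit_measure) = (\<integral>x. norm2 unit_measure f ^ 2 * indicator {a<..b} x \<partial>unit_measure)"
        by (intro Bochner_Integration.integral_cong) (auto simp: indicator_def)
      also have "\<dots> = norm2 unit_measure f ^ 2 * measure unit_measure ({a<..b} \<inter> space unit_measure)"
        by simp
      also have "measure unit_measure ({a<..b} \<inter> space unit_measure) = b - a"
      proof -
        have "{a<..b} \<inter> space unit_measure = {a<..b}" using ab by auto
        moreover have "measure unit_measure {a<..b} = measure lebesgue {a<..b}"
          using ab by (intro measure_restrict_space) auto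
        ultimately show ?thesis using ab by simp
      qed
      finally show ?thesis by (simp add: norm2_def)
    qed
    also have "\<dots> = sqrt (b - a) * norm2 unit_measure f" by (simp add: real_sqrt_mult)
    finally show "norm2 unit_measure (\<lambda>x. (if x \<le> b then ?F x else 0) - (if x \<le> a then ?F x else 0))
        \<le> sqrt (b - a) * norm2 unit_measure f" .
  qed
  then show "norm (((cutoff b - cutoff a) o\<^sub>L volterra) f) \<le> sqrt (b - a) * norm f"
    by (simp add: blinfun.diff_left cutoff.rep_eq volterra.rep_eq)
qed (use assms in simp)

text \<open>Cutting \<open>[0,1]\<close> into \<open>m\<close> equal intervals gives diagonal blocks of norm at most \<open>1/\<surd>m\<close>.\<close>

lemma volterra_mem_radical:
  "volterra \<in> radical scale_L2 (generated_Banach_algebra (scale_L2 :: 'k::{real_normed_field, euclidean_space} \<Rightarrow> _)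
    (super_left_commutant scale_L2 volterra \<union> super_right_commutant scale_L2 volterra))"
proof (rule L2.radical_of_small_diagonal[OF _ _ volterra_super_commutants_subset_nest_algebra])
  show "cutoff ` {0..1} \<subseteq> bounded_operators (scale_L2 :: 'k \<Rightarrow> _)"
    by (auto intro: cutoff_mem_bounded_operators)
  show "P o\<^sub>L P = P" if "P \<in> cutoff ` {0..1}" for P :: "'k L2 \<Rightarrow>\<^sub>L 'k L2"
    using that by (auto simp: cutoff_cutoff)
  have "(0 :: 'k L2 \<Rightarrow>\<^sub>L 'k L2) \<in> positive_operators scale_L2"
    by (simp add: positive_operators_def L2.bounded_operators_iff)
  then show "volterra \<in> super_left_commutant scale_L2 volterra \<union> super_right_commutant (scale_L2 :: 'k \<Rightarrow> _) volterra"
    by (intro UnI2) (simp add: super_right_commutant_def volterra_positive)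
  let ?V = "volterra :: 'k L2 \<Rightarrow>\<^sub>L 'k L2"
  fix \<epsilon> :: real assume \<epsilon>: "\<epsilon> > 0"
  obtain m where m: "m > 0" "inverse (real m) < \<epsilon>\<^sup>2"
    using ex_inverse_of_nat_less[of "\<epsilon>\<^sup>2"] \<epsilon> by auto
  define P :: "nat \<Rightarrow> 'k L2 \<Rightarrow>\<^sub>L 'k L2" where "P i = cutoff (real i / real m)" for i
  show "\<exists>P m. P 0 = 0 \<and> P m = id_blinfun \<and> (\<forall>i\<le>m. P i \<in> cutoff ` {0..1}) \<and>
      (\<forall>i<m. P i o\<^sub>L P (Suc i) = P i \<and> P (Suc i) o\<^sub>L P i = P i \<and> norm (P (Suc i) - P i) \<le> 1 \<and>
        norm ((P (Suc i) - P i) o\<^sub>L ?V o\<^sub>L (P (Suc i) - P i)) < \<epsilon>)"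
  proof (intro exI[of _ P] exI[of _ m] conjI allI impI)
    show "P 0 = 0" by (intro blinfun_eqI) (simp add: P_def cutoff_eq_0_of_smaller)
    show "P m = id_blinfun" using m(1) by (simp add: P_def cutoff_1)
    show "P i \<in> cutoff ` {0..1}" if "i \<le> m" for i using m(1) that by (auto simp: P_def)
    fix i assume i: "i < m"
    have le: "real i / real m \<le> real (Suc i) / real m" by (intro divide_right_mono) auto
    then show "P i o\<^sub>L P (Suc i) = P i" "P (Suc i) o\<^sub>L P i = P i"
      by (auto simp: P_def cutoff_cutoff min_def)
    show E: "norm (P (Suc i) - P i) \<le> 1" unfolding P_def by (rule norm_cutoff_diff[OF le])
    have "norm ((P (Suc i) - P i) o\<^sub>L ?V o\<^sub>L (P (Suc i) - P i))
        \<le> norm ((P (Suc i) - P i) o\<^sub>L ?V) * norm (P (Suc i) - P i)"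
      by (rule norm_blinfun_compose)
    also have "\<dots> \<le> norm ((P (Suc i) - P i) o\<^sub>L ?V) * 1"
      by (intro mult_left_mono E) auto
    also have "\<dots> \<le> sqrt (real (Suc i) / real m - real i / real m)"
      using norm_cutoff_diff_volterra[OF _ le] i by (simp add: P_def)
    also have "real (Suc i) / real m - real i / real m = inverse (real m)"
      using m(1) by (simp add: field_simps)
    also have "sqrt (inverse (real m)) < \<epsilon>"
      using m(2) \<epsilon> by (intro real_less_lsqrt) auto
    finally show "norm ((P (Suc i) - P i) o\<^sub>L ?V o\<^sub>L (P (Suc i) - P i)) < \<epsilon>" .
  qed
qed


section \<open>The radical\<close>

theorem theorem5p4:
  fixes w :: "nat \<Rightarrow> real"
    and V :: "'k::{real_normed_field, euclidean_space} L2 \<Rightarrow>\<^sub>L 'k L2"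
    and S :: "'k l2 \<Rightarrow>\<^sub>L 'k l2"
  assumes w_pos: "\<And>n. n \<ge> 1 \<Longrightarrow> w n > 0"
    and w_decreasing: "\<And>m n. 1 \<le> m \<Longrightarrow> m \<le> n \<Longrightarrow> w n \<le> w m"
    and w_l2: "summable (\<lambda>n. (w (Suc n))\<^sup>2)"
    and V: "V = volterra"
    and S: "S = donoghue w"
  shows "V \<in> radical scale_L2 (generated_Banach_algebra scale_L2
             (super_left_commutant scale_L2 V \<union> super_right_commutant scale_L2 V)) \<and>
         S \<in> radical scale_l2 (generated_Banach_algebra scale_l2
             (super_left_commutant scale_l2 S \<union> super_right_commutant scale_l2 S))"
proof
  show "V \<in> radical scale_L2 (generated_Banach_algebra scale_L2
      (super_left_commutant scale_L2 V \<union> super_right_commutant scale_L2 V))"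
    unfolding V by (rule volterra_mem_radical)
  show "S \<in> radical scale_l2 (generated_Banach_algebra scale_l2
      (super_left_commutant scale_l2 S \<union> super_right_commutant scale_l2 S))"
    unfolding S by (rule donoghue_mem_radical[OF w_pos w_decreasing w_l2])
qed

end
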